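(* $[1,1,1,1]=4$. That is: let $n\ge 4$, let $r$ be a (deleted) red vertex in $\mathcal{Q}_n$, and let $r_1,g,g_1,g_2$ be one red vertex $r_1$ and three distinct green vertices $g,g_1,g_2$ in $\mathcal{Q}_n-\{r\}$. Then there exists a $2$-path covering of $\mathcal{Q}_n-\{r\}$ with one path connecting $r_1$ to $g$ and the other connecting $g_1$ to $g_2$. The claim is not true for $n=3$ (there are such vertices in $\mathcal{Q}_3$ for which no such covering exists).
   Context: $\mathcal{Q}_n$ is the $n$-dimensional binary hypercube: its vertices are all binary sequences of length $n$, adjacent iff they differ in exactly one position. A vertex is even or odd according to the parity of its number of 1's; vertices of one parity are called red and those of the other parity green. A path covering of a graph is a set of vertex-disjoint paths that cover all vertices of the graph; a $k$-path covering is a path covering by exactly $k$ paths. A fault $\mathcal{F}$ in $\mathcal{Q}_n$ is a set of deleted vertices; its mass is $|\mathcal{F}|$ and its charge is $|r(\mathcal{F})-g(\mathcal{F})|$, where $r(\mathcal{F})$, $g(\mathcal{F})$ are the numbers of red and green vertices in $\mathcal{F}$. $\mathcal{Q}_n-\mathcal{F}$ is the subgraph induced by the non-deleted vertices. A pair of vertices (or a path, via its two endpoints) is neutral if the two vertices have opposite parity and charged if they have the same parity; a charged pair is red (green) if its elements are red (green). A set $\mathcal{E}$ of disjoint pairs of vertices is in balance with $\mathcal{F}$ if all vertices in the pairs lie in $\mathcal{Q}_n-\mathcal{F}$ and $r(\mathcal{F})-g(\mathcal{F})=g(\mathcal{E})-r(\mathcal{E})$, where $r(\mathcal{E})$, $g(\mathcal{E})$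 are the numbers of red and green pairs in $\mathcal{E}$. For a fault $\mathcal{F}$ of mass $M$ and charge $C$ in $\mathcal{Q}_n$, one can freely prescribe ends for a path covering of $\mathcal{Q}_n-\mathcal{F}$ with $N$ neutral paths and $O$ charged paths if (i) there is at least one set $\mathcal{E}$ of disjoint pairs of vertices in balance with $\mathcal{F}$ containing exactly $N$ neutral and $O$ charged pairs, and (ii) for every such $\mathcal{E}$ there is a path covering of $\mathcal{Q}_n-\mathcal{F}$ whose set of pairs of end vertices is $\mathcal{E}$. For nonnegative integers $M,C,N,O$, $\mathcal{A}_{M,C,N,O}$ is the set of nonnegative integers $m$ such that $m\ge\log_2[M+C+2N+2O]$ and for every $n\ge m$ and every fault $\mathcal{F}$ of mass $M$ and charge $C$ in $\mathcal{Q}_n$ one can freely prescribe ends for a path covering of $\mathcal{Q}_n-\mathcal{F}$ with $N$ neutral and $O$ charged paths. $[M,C,N,O]$ is the smallest element of $\mathcal{A}_{M,C,N,O}$ if this set is nonempty. *)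

theory Defs
  imports Complex_Main "HOL-Library.Disjoint_Sets" "Graph_Theory.Graph_Theory"
begin

text \<open>Undirected graphs are symmetric digraphs, as usual in \<open>Graph_Theory\<close>.\<close>

definition hypercube :: "nat \<Rightarrow> bool list pair_pre_digraph" where
  "hypercube n =
     \<lparr> pverts = {v. length v = n},
       parcs = {(u, v). length u = n \<and> length v = n \<and> (\<exists>!i. i < n \<and> u ! i \<noteq> v ! i)} \<rparr>"

lemma pair_graph_hypercube: "pair_graph (hypercube n)"
proof -
  have fin: "finite {v :: bool list. length v = n}"
    using finite_lists_length_eq[of "UNIV :: bool set" n] by simp
  have verts: "finite (pverts (hypercube n))"
    using fin by (simp add: hypercube_def)
  have arcs: "finite (parcs (hypercube n))"
    by (rule finite_subset[OF _ finite_cartesian_product[OF fin fin]])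
       (auto simp: hypercube_def)
  have swap: "(v, u) \<in> parcs (hypercube n)" if "(u, v) \<in> parcs (hypercube n)" for u v
  proof -
    have eq: "(i < n \<and> v ! i \<noteq> u ! i) = (i < n \<and> u ! i \<noteq> v ! i)" for i
      by blast
    show ?thesis
      using that unfolding hypercube_def pair_pre_digraph.simps mem_Collect_eq case_prod_conv eq
      by blast
  qed
  have sym: "symmetric (with_proj (hypercube n))"
    unfolding symmetric_def with_proj_simps using swap by (rule symI)
  have in_verts: "fst e \<in> pverts (hypercube n)" "snd e \<in> pverts (hypercube n)"
    and no_loop: "fst e \<noteq> snd e" if "e \<in> parcs (hypercube n)" for e
    using that unfolding hypercube_def by (cases e; fastforce)+
  show ?thesis
    by unfold_locales (fact verts arcs sym in_verts no_loop)+
qed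

definition faulty_cube :: "nat \<Rightarrow> bool list set \<Rightarrow> (bool list, bool list \<times> bool list) pre_digraph" where
  "faulty_cube n F = with_proj (hypercube n) \<restriction> (pverts (hypercube n) - F)"

text \<open>Which parity class is called red is left open: the argument \<open>c\<close> below selects it
  (\<open>c = True\<close>: the even vertices are red; \<open>c = False\<close>: the odd ones).\<close>

definition even_vertex :: "bool list \<Rightarrow> bool" where
  "even_vertex v \<longleftrightarrow> even (count_list v True)"

definition red :: "bool \<Rightarrow> bool list \<Rightarrow> bool" where
  "red c v \<longleftrightarrow> even_vertex v = c"

abbreviation green :: "bool \<Rightarrow> bool list \<Rightarrow> bool" where
  "green c v \<equiv> \<not> red c v"

definition path_covering :: "('a, 'b) pre_digraph \<Rightarrow> 'a vwalk set \<Rightarrow> bool" where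
  "path_covering G P \<longleftrightarrow>
     (\<forall>p\<in>P. vpath p G) \<and> disjoint_family_on set P \<and> (\<Union>p\<in>P. set p) = verts G"

definition k_path_covering :: "nat \<Rightarrow> ('a, 'b) pre_digraph \<Rightarrow> 'a vwalk set \<Rightarrow> bool" where
  "k_path_covering k G P \<longleftrightarrow> path_covering G P \<and> finite P \<and> card P = k"

definition connects :: "'a vwalk \<Rightarrow> 'a \<Rightarrow> 'a \<Rightarrow> bool" where
  "connects p u v \<longleftrightarrow> hd p = u \<and> last p = v"

definition end_pairs :: "'a vwalk set \<Rightarrow> 'a set set" where
  "end_pairs P = (\<lambda>p. {hd p, last p}) ` P"

definition fault :: "nat \<Rightarrow> bool list set \<Rightarrow> bool" where
  "fault n F \<longleftrightarrow> F \<subseteq> pverts (hypercube n)"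

definition mass :: "bool list set \<Rightarrow> nat" where
  "mass F = card F"

definition red_excess :: "bool \<Rightarrow> bool list set \<Rightarrow> int" where
  "red_excess c F = int (card {v \<in> F. red c v}) - int (card {v \<in> F. green c v})"

definition charge :: "bool \<Rightarrow> bool list set \<Rightarrow> nat" where
  "charge c F = nat \<bar>red_excess c F\<bar>"

text \<open>A pair is an unordered pair of distinct vertices, i.e. a set of cardinality two.\<close>

definition neutral :: "bool list set \<Rightarrow> bool" where
  "neutral e \<longleftrightarrow> (\<exists>u v. e = {u, v} \<and> even_vertex u \<noteq> even_vertex v)"

definition charged :: "bool list set \<Rightarrow> bool" where
  "charged e \<longleftrightarrow> (\<exists>u v. e = {u, v} \<and> u \<noteq> v \<and> even_vertex u = even_vertex v)"

definition red_pair :: "bool \<Rightarrow> bool list set \<Rightarrow> bool" where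
  "red_pair c e \<longleftrightarrow> charged e \<and> (\<forall>v\<in>e. red c v)"

definition green_pair :: "bool \<Rightarrow> bool list set \<Rightarrow> bool" where
  "green_pair c e \<longleftrightarrow> charged e \<and> (\<forall>v\<in>e. green c v)"

definition disjoint_pairs :: "'a set set \<Rightarrow> bool" where
  "disjoint_pairs E \<longleftrightarrow> (\<forall>e\<in>E. card e = 2) \<and> disjoint E"

definition in_balance :: "bool \<Rightarrow> nat \<Rightarrow> bool list set \<Rightarrow> bool list set set \<Rightarrow> bool" where
  "in_balance c n F E \<longleftrightarrow>
     \<Union>E \<subseteq> verts (faulty_cube n F) \<and>
     red_excess c F = int (card {e \<in> E. green_pair c e}) - int (card {e \<in> E. red_pair c e})"

text \<open>\<open>N\<close> is the number of neutral, \<open>K\<close> the number of charged pairs.\<close>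

definition prescribable_ends ::
    "bool \<Rightarrow> nat \<Rightarrow> bool list set \<Rightarrow> nat \<Rightarrow> nat \<Rightarrow> bool list set set \<Rightarrow> bool" where
  "prescribable_ends c n F N K E \<longleftrightarrow>
     disjoint_pairs E \<and> in_balance c n F E \<and>
     card {e \<in> E. neutral e} = N \<and> card {e \<in> E. charged e} = K"

definition freely_prescribe_ends :: "bool \<Rightarrow> nat \<Rightarrow> bool list set \<Rightarrow> nat \<Rightarrow> nat \<Rightarrow> bool" where
  "freely_prescribe_ends c n F N K \<longleftrightarrow>
     (\<exists>E. prescribable_ends c n F N K E) \<and>
     (\<forall>E. prescribable_ends c n F N K E \<longrightarrow>
        (\<exists>P. path_covering (faulty_cube n F) P \<and> end_pairs P = E))"

definition A_set :: "bool \<Rightarrow> nat \<Rightarrow> nat \<Rightarrow> nat \<Rightarrow> nat \<Rightarrow> nat set" where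
  "A_set c M C N K =
     {m. log 2 (real (M + C + 2 * N + 2 * K)) \<le> real m \<and>
         (\<forall>n\<ge>m. \<forall>F. fault n F \<and> mass F = M \<and> charge c F = C \<longrightarrow>
            freely_prescribe_ends c n F N K)}"

text \<open>The number \<open>[M, C, N, O]\<close>; \<open>None\<close> if it is undefined.\<close>

definition bracket :: "bool \<Rightarrow> nat \<Rightarrow> nat \<Rightarrow> nat \<Rightarrow> nat \<Rightarrow> nat option" where
  "bracket c M C N K =
     (if A_set c M C N K = {} then None else Some (LEAST m. m \<in> A_set c M C N K))"

text \<open>\<open>r\<close> is the deleted vertex, \<open>r1\<close>, \<open>g\<close> and \<open>g1\<close>, \<open>g2\<close> are the ends to be joined.\<close>

definition admissible_vertices ::
    "bool \<Rightarrow> nat \<Rightarrow> bool list \<Rightarrow> bool list \<Rightarrow> bool list \<Rightarrow> bool list \<Rightarrow> bool list \<Rightarrow> bool" where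
  "admissible_vertices c n r r1 g g1 g2 \<longleftrightarrow>
     r \<in> pverts (hypercube n) \<and> red c r \<and>
     {r1, g, g1, g2} \<subseteq> verts (faulty_cube n {r}) \<and>
     red c r1 \<and> green c g \<and> green c g1 \<and> green c g2 \<and>
     g \<noteq> g1 \<and> g \<noteq> g2 \<and> g1 \<noteq> g2"

definition has_2_path_covering ::
    "nat \<Rightarrow> bool list \<Rightarrow> bool list \<Rightarrow> bool list \<Rightarrow> bool list \<Rightarrow> bool list \<Rightarrow> bool" where
  "has_2_path_covering n r r1 g g1 g2 \<longleftrightarrow>
     (\<exists>p q. k_path_covering 2 (faulty_cube n {r}) {p, q} \<and>
        connects p r1 g \<and> connects q g1 g2)"

end

theory Submission
  imports Defs
begin

text \<open>
  Let \<open>r\<close> be the deleted vertex, and let \<open>x\<close>, \<open>y\<close> and \<open>u\<close>, \<open>v\<close> be the ends to be joined.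
  All lemmas compare the parity of a vertex with that of another vertex instead of naming colours,
  so that both colour conventions are treated at once: \<open>x\<close> has the parity of \<open>r\<close>, and
  \<open>y\<close>, \<open>u\<close>, \<open>v\<close> have the other one.

  For \<open>n \<ge> 4\<close> the covering is built by induction on \<open>n\<close>. The cube is cut into two halves along a
  coordinate in which \<open>u\<close> and \<open>v\<close> differ; by symmetry \<open>r\<close> lies in the half of \<open>u\<close>. The half
  without \<open>r\<close> has as many even as odd vertices and is covered by one or two neutral paths. In the
  half of \<open>r\<close> one parity is short of a vertex, which a charged path starting in \<open>u\<close> makes up for;
  a second path of that half, if there is one, is neutral, and then the induction hypothesis
  applies. The pieces are joined by edges between the halves, and \<open>x\<close> and \<open>y\<close> may lie anywhere:
  each of the four distributions needs only concatenation, since \<open>u\<close> and \<open>v\<close> are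
  separated. The crossing edges must avoid at most three vertices of one parity, and a cube of
  dimension at least three has four of each.

  The three auxiliary coverings are proved by the same cut along a separating coordinate:
  a Hamiltonian path between vertices of different parity (\<open>laceable\<close>), one between vertices of
  equal parity after deletion of a vertex of the other parity (\<open>hyperlaceable\<close>), and two neutral
  paths (\<open>two_neutral_paths\<close>). The inductions for two paths start in dimensions three and four with
  explicit tables of paths. Translations and permutations of coordinates are parity-respecting
  automorphisms of the cube; they reduce the positions to be tabulated to 18 and 126.

  In dimension three there is an undeleted vertex \<open>w\<close>, not an end, next to \<open>r\<close> and to the end \<open>x\<close>.
  Its path must run from \<open>x\<close> through \<open>w\<close> to the third neighbour of \<open>w\<close>, from where it can only
  go on to an end of the other path (\<open>no_two_paths_3\<close>).

  Finally, the sets of pairs admitted in the definition of the bracket are exactly the sets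
  \<open>{{x, y}, {u, v}}\<close> with parities as above (\<open>prescribable_ends_one_one_iff\<close>), and a path covering
  with these end pairs amounts to one by two paths with these ends
  (\<open>covering_with_end_pairs_iff\<close>). Hence the numbers admitted are those from 4 on.
\<close>

section \<open>Adjacency, parity and subcubes\<close>

abbreviation cube :: "nat \<Rightarrow> bool list set" where
  "cube n \<equiv> {v. length v = n}"

text \<open>A form of adjacency suited to induction on lists; \<open>adj_iff_nth\<close> relates it to the arcs of
  \<open>hypercube\<close>.\<close>

fun adj :: "bool list \<Rightarrow> bool list \<Rightarrow> bool" where
  "adj (a # u) (b # v) = (if a = b then adj u v else u = v)"
| "adj u v = False"

lemma adj_sym: "adj u v \<Longrightarrow> adj v u"
  by (induction u v rule: adj.induct) (auto split: if_splits)

lemma even_vertex_Nil [simp]: "even_vertex []"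
  by (simp add: even_vertex_def)

lemma even_vertex_Cons [simp]: "even_vertex (a # v) = (even_vertex v \<noteq> a)"
  by (auto simp: even_vertex_def)

text \<open>The parity of the remaining entries decides the first one, so each parity class of
  \<open>cube (Suc m)\<close> is as large as \<open>cube m\<close>.\<close>

lemma exists_vertex_of_parity:
  assumes "length as < 2 ^ m"
  shows "\<exists>x. length x = Suc m \<and> even_vertex x = e \<and> x \<notin> set as"
proof -
  let ?f = "\<lambda>v. (even_vertex v \<noteq> e) # v"
  have "card (?f ` cube m) = 2 ^ m"
    using card_lists_length_eq[of "UNIV :: bool set" m]
    by (subst card_image) (auto simp: inj_on_def)
  then have "card (set as) < card (?f ` cube m)"
    using assms card_length[of as] by simp
  then have "\<not> ?f ` cube m \<subseteq> set as"
    using card_mono[of "set as"] by (meson finite_set not_le)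
  then obtain v where "length v = m" "?f v \<notin> set as" by auto
  then show ?thesis by (intro exI[of _ "?f v"]) auto
qed

lemma exists_vertex_avoiding:
  assumes "3 \<le> n"
  obtains x where "length x = n" "even_vertex x = e" "x \<noteq> a" "x \<noteq> b" "x \<noteq> c"
proof -
  obtain m where n: "n = Suc m" and m: "2 \<le> m" using assms by (cases n) auto
  have "(2::nat) ^ 2 \<le> 2 ^ m" using m by (intro power_increasing) auto
  then have "length [a, b, c] < 2 ^ m" by simp
  from exists_vertex_of_parity[OF this, of e] show ?thesis
    using that n by auto
qed

text \<open>For fixed \<open>i \<le> n\<close>, the maps \<open>insert_at i False\<close> and \<open>insert_at i True\<close> identify \<open>cube n\<close> with the
  two halves of \<open>cube (Suc n)\<close> in which coordinate \<open>i\<close> is constant. One of them preserves parity and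
  the other one reverses it.\<close>

fun insert_at :: "nat \<Rightarrow> bool \<Rightarrow> bool list \<Rightarrow> bool list" where
  "insert_at (Suc i) b (a # v) = a # insert_at i b v"
| "insert_at i b v = b # v"

lemma length_insert_at [simp]: "length (insert_at i b v) = Suc (length v)"
  by (induction i b v rule: insert_at.induct) auto

lemma even_vertex_insert_at [simp]: "even_vertex (insert_at i b v) = (even_vertex v \<noteq> b)"
  by (induction i b v rule: insert_at.induct) auto

lemma insert_at_inject [simp]:
  "length u = length w \<Longrightarrow> insert_at i b u = insert_at i c w \<longleftrightarrow> b = c \<and> u = w"
  by (induction i b u arbitrary: w rule: insert_at.induct) (case_tac w; auto)+

lemma adj_insert_at: "adj u v \<Longrightarrow> adj (insert_at i b u) (insert_at i b v)"
  by (induction u v arbitrary: i rule: adj.induct)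
    (case_tac i; auto split: if_splits)+

lemma adj_insert_at_across: "adj (insert_at i b v) (insert_at i (\<not> b) v)"
  by (induction i b v rule: insert_at.induct) auto

lemma insert_at_surj:
  "length v = Suc n \<Longrightarrow> i \<le> n \<Longrightarrow> \<exists>b u. length u = n \<and> v = insert_at i b u"
proof (induction n arbitrary: i v)
  case 0
  then show ?case by (auto simp: length_Suc_conv)
next
  case (Suc n)
  then obtain a w where v: "v = a # w" "length w = Suc n" by (auto simp: length_Suc_conv)
  show ?case
  proof (cases i)
    case 0
    then show ?thesis using v by (intro exI[of _ a] exI[of _ w]) simp
  next
    case (Suc j)
    then obtain b u where "length u = n" "w = insert_at j b u"
      using Suc.IH[of w j] Suc.prems v by auto
    then show ?thesis using v Suc by (intro exI[of _ b] exI[of _ "a # u"]) simp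
  qed
qed

lemma insert_at_cases:
  assumes "length v = Suc n" "i \<le> n"
  obtains u where "length u = n" "v = insert_at i b u"
    | u where "length u = n" "v = insert_at i (\<not> b) u"
proof -
  obtain c u where "length u = n" "v = insert_at i c u" using insert_at_surj[OF assms] by blast
  then show thesis using that by (cases "c = b") auto
qed

lemma insert_at_cases2:
  assumes "length v = Suc n" "length w = Suc n" "i \<le> n"
  obtains
    (bb) v' w' where "length v' = n" "length w' = n" "v = insert_at i b v'" "w = insert_at i b w'"
  | (bn) v' w' where "length v' = n" "length w' = n" "v = insert_at i b v'" "w = insert_at i (\<not> b) w'"
  | (nb) v' w' where "length v' = n" "length w' = n" "v = insert_at i (\<not> b) v'" "w = insert_at i b w'"
  | (nn) v' w' where "length v' = n" "length w' = n" "v = insert_at i (\<not> b) v'" "w = insert_at i (\<not> b) w'"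
  by (rule insert_at_cases[OF assms(1,3), where b = b];
      rule insert_at_cases[OF assms(2,3), where b = b]; rule that; assumption)

text \<open>Every induction step below rests on this choice: along a coordinate in which two ends
  differ, the cube is cut so that these ends lie in different halves.\<close>

lemma separating_coordinate:
  assumes "length u = Suc n" "length v = Suc n" "u \<noteq> v"
  obtains i b u' v' where "i \<le> n" "length u' = n" "length v' = n"
    "u = insert_at i b u'" "v = insert_at i (\<not> b) v'"
proof -
  have "\<exists>i b u' v'. i \<le> n \<and> length u' = n \<and> length v' = n \<and>
    u = insert_at i b u' \<and> v = insert_at i (\<not> b) v'"
    using assms
  proof (induction n arbitrary: u v)
    case 0
    then obtain a c where "u = [a]" "v = [c]" "c = (\<not> a)"
      by (auto simp: length_Suc_conv)
    then show ?case by (intro exI[of _ 0] exI[of _ a] exI[of _ "[]"]) auto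
  next
    case (Suc n)
    then obtain a s c t where uv: "u = a # s" "v = c # t" "length s = Suc n" "length t = Suc n"
      by (metis length_Suc_conv)
    show ?case
    proof (cases "a = c")
      case True
      then obtain i b s' t' where "i \<le> n" "length s' = n" "length t' = n"
        "s = insert_at i b s'" "t = insert_at i (\<not> b) t'"
        using Suc.IH[of s t] Suc.prems uv by auto
      then show ?thesis using True uv
        by (intro exI[of _ "Suc i"] exI[of _ b] exI[of _ "a # s'"] exI[of _ "a # t'"]) simp
    next
      case False
      then show ?thesis using uv
        by (intro exI[of _ 0] exI[of _ a] exI[of _ s] exI[of _ t]) auto
    qed
  qed
  then show ?thesis using that by blast
qed

lemma cube_split:
  assumes "i \<le> n"
  shows "cube (Suc n) = insert_at i b ` cube n \<union> insert_at i (\<not> b) ` cube n" (is "?L = ?R")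
proof
  show "?L \<subseteq> ?R"
  proof
    fix v assume "v \<in> ?L"
    then have "length v = Suc n" by simp
    then show "v \<in> ?R" using assms by (rule insert_at_cases[where b = b]) auto
  qed
qed auto

lemma cube_split_minus:
  assumes "i \<le> n" "length r = n"
  shows "cube (Suc n) - {insert_at i b r} =
    insert_at i b ` (cube n - {r}) \<union> insert_at i (\<not> b) ` cube n"
  using assms by (auto simp: cube_split[OF assms(1), of b])

lemma subcubes_disjoint:
  assumes "S \<subseteq> cube n" "T \<subseteq> cube n"
  shows "insert_at i b ` S \<inter> insert_at i (\<not> b) ` T = {}"
proof -
  have "insert_at i b s \<noteq> insert_at i (\<not> b) t" if "s \<in> S" "t \<in> T" for s t
    using that assms by (subst insert_at_inject) auto
  then show ?thesis by blast
qed

lemma inj_on_insert_at: "inj_on (insert_at i b) (cube n)"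
  by (auto simp: inj_on_def)

lemma insert_at_image_disjoint:
  "S \<inter> T = {} \<Longrightarrow> S \<subseteq> cube n \<Longrightarrow> T \<subseteq> cube n \<Longrightarrow>
    insert_at i b ` S \<inter> insert_at i b ` T = {}"
  using inj_on_image_Int[OF inj_on_insert_at, of S n T i b] by simp

section \<open>Path coverings with prescribed ends\<close>

definition path_between :: "bool list list \<Rightarrow> bool list \<Rightarrow> bool list \<Rightarrow> bool" where
  "path_between p u v \<longleftrightarrow>
     p \<noteq> [] \<and> distinct p \<and> successively adj p \<and> hd p = u \<and> last p = v"

definition linked1 :: "bool list set \<Rightarrow> bool list \<Rightarrow> bool list \<Rightarrow> bool" where
  "linked1 S u v \<longleftrightarrow> (\<exists>p. path_between p u v \<and> set p = S)"

definition linked2 ::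
    "bool list set \<Rightarrow> bool list \<Rightarrow> bool list \<Rightarrow> bool list \<Rightarrow> bool list \<Rightarrow> bool" where
  "linked2 S u v w z \<longleftrightarrow> (\<exists>p q. path_between p u v \<and> path_between q w z \<and>
     set p \<inter> set q = {} \<and> set p \<union> set q = S)"

lemma path_between_rev: "path_between p u v \<Longrightarrow> path_between (rev p) v u"
  unfolding path_between_def
  by (auto simp: hd_rev last_rev successively_rev elim: successively_mono dest: adj_sym)

lemma path_between_append:
  "path_between p u x \<Longrightarrow> path_between q y v \<Longrightarrow> adj x y \<Longrightarrow> set p \<inter> set q = {} \<Longrightarrow>
    path_between (p @ q) u v"
  unfolding path_between_def by (auto simp: successively_append_iff)

lemma path_between_map:
  assumes "path_between p u v" "inj_on f (set p)"
    "\<And>x y. x \<in> set p \<Longrightarrow> y \<in> set p \<Longrightarrow> adj x y \<Longrightarrow> adj (f x) (f y)"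
  shows "path_between (map f p) (f u) (f v)"
  using assms unfolding path_between_def
  by (auto simp: distinct_map hd_map last_map successively_map elim!: successively_mono)

lemma linked2_map:
  assumes "linked2 S u v w z" "inj_on f S"
    "\<And>x y. x \<in> S \<Longrightarrow> y \<in> S \<Longrightarrow> adj x y \<Longrightarrow> adj (f x) (f y)"
  shows "linked2 (f ` S) (f u) (f v) (f w) (f z)"
proof -
  from assms(1) obtain p q where pq: "path_between p u v" "path_between q w z"
    "set p \<inter> set q = {}" and S: "S = set p \<union> set q"
    unfolding linked2_def by blast
  have "path_between (map f p) (f u) (f v)" "path_between (map f q) (f w) (f z)"
    using pq assms(2,3) S by (auto intro!: path_between_map elim: inj_on_subset)
  moreover have "set (map f p) \<inter> set (map f q) = {}"
    using pq(3) assms(2) S by (auto simp: inj_on_def)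
  ultimately show ?thesis unfolding linked2_def S
    by (metis image_Un list.set_map)
qed

lemma linked2_rev1: "linked2 S u v w z \<Longrightarrow> linked2 S v u w z"
  unfolding linked2_def by (metis path_between_rev set_rev)

lemma linked2_rev2: "linked2 S u v w z \<Longrightarrow> linked2 S u v z w"
  unfolding linked2_def by (metis path_between_rev set_rev)

lemma linked2_swap: "linked2 S u v w z \<Longrightarrow> linked2 S w z u v"
  unfolding linked2_def by (metis Int_commute Un_commute)

lemma path_between_insert_at:
  "path_between p u v \<Longrightarrow> set p \<subseteq> cube n \<Longrightarrow>
    path_between (map (insert_at i b) p) (insert_at i b u) (insert_at i b v)"
  by (rule path_between_map) (auto intro: inj_on_subset[OF inj_on_insert_at] adj_insert_at)

text \<open>The gluing lemmas join a path ending at the copy of \<open>x\<close> in one half to a path starting at the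
  copy of \<open>x\<close> in the other half. The covered sets are arbitrary subsets of the
  halves, so that a deleted vertex is allowed for.\<close>

lemma linked1_glue:
  assumes "linked1 S u x" "linked1 T x v" "S \<subseteq> cube n" "T \<subseteq> cube n"
  shows "linked1 (insert_at i b ` S \<union> insert_at i (\<not> b) ` T) (insert_at i b u) (insert_at i (\<not> b) v)"
proof -
  from assms obtain p q where p: "path_between p u x" "set p = S"
    and q: "path_between q x v" "set q = T"
    unfolding linked1_def by blast
  let ?p = "map (insert_at i b) p" and ?q = "map (insert_at i (\<not> b)) q"
  have "path_between (?p @ ?q) (insert_at i b u) (insert_at i (\<not> b) v)"
    using path_between_insert_at[OF p(1)] path_between_insert_at[OF q(1)] p(2) q(2) assms(3,4)
      subcubes_disjoint[OF assms(3,4)]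
    by (intro path_between_append[OF _ _ adj_insert_at_across]) auto
  then show ?thesis unfolding linked1_def
    by (intro exI[of _ "?p @ ?q"]) (simp add: p q)
qed

lemma linked2_side_by_side:
  assumes "linked1 S u v" "linked1 T w z" "S \<subseteq> cube n" "T \<subseteq> cube n"
  shows "linked2 (insert_at i b ` S \<union> insert_at i (\<not> b) ` T)
    (insert_at i b u) (insert_at i b v) (insert_at i (\<not> b) w) (insert_at i (\<not> b) z)"
proof -
  from assms obtain p q where p: "path_between p u v" "set p = S"
    and q: "path_between q w z" "set q = T"
    unfolding linked1_def by blast
  show ?thesis unfolding linked2_def
    using path_between_insert_at[OF p(1)] path_between_insert_at[OF q(1)] p(2) q(2) assms(3,4)
      subcubes_disjoint[OF assms(3,4)]
    by (intro exI[of _ "map (insert_at i b) p"] exI[of _ "map (insert_at i (\<not> b)) q"]) auto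
qed

lemma linked2_glue1:
  assumes "linked2 S u v w x" "linked1 T x z" "S \<subseteq> cube n" "T \<subseteq> cube n"
  shows "linked2 (insert_at i b ` S \<union> insert_at i (\<not> b) ` T)
    (insert_at i b u) (insert_at i b v) (insert_at i b w) (insert_at i (\<not> b) z)"
proof -
  from assms obtain p q s where pq: "path_between p u v" "path_between q w x"
      "set p \<inter> set q = {}" and S: "S = set p \<union> set q"
    and s: "path_between s x z" "set s = T"
    unfolding linked1_def linked2_def by blast
  let ?p = "map (insert_at i b) p" and ?q = "map (insert_at i b) q"
    and ?s = "map (insert_at i (\<not> b)) s"
  have sub: "set p \<subseteq> cube n" "set q \<subseteq> cube n" "set s \<subseteq> cube n" using assms S s by auto
  have "path_between (?q @ ?s) (insert_at i b w) (insert_at i (\<not> b) z)"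
    using path_between_insert_at[OF pq(2) sub(2)] path_between_insert_at[OF s(1) sub(3)]
      subcubes_disjoint[OF sub(2,3)]
    by (intro path_between_append[OF _ _ adj_insert_at_across]) auto
  moreover have "set ?p \<inter> set (?q @ ?s) = {}"
    using insert_at_image_disjoint[OF pq(3) sub(1,2), of i b] subcubes_disjoint[OF sub(1,3), of i b]
    by (simp add: Int_Un_distrib)
  ultimately show ?thesis unfolding linked2_def
    using path_between_insert_at[OF pq(1) sub(1)]
    by (intro exI[of _ ?p] exI[of _ "?q @ ?s"]) (auto simp: S s)
qed

lemma linked2_glue2:
  assumes "linked2 S u x w y" "linked2 T x v y z" "S \<subseteq> cube n" "T \<subseteq> cube n"
  shows "linked2 (insert_at i b ` S \<union> insert_at i (\<not> b) ` T)
    (insert_at i b u) (insert_at i (\<not> b) v) (insert_at i b w) (insert_at i (\<not> b) z)"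
proof -
  from assms obtain p q s t where pq: "path_between p u x" "path_between q w y"
      "set p \<inter> set q = {}" and S: "S = set p \<union> set q"
    and st: "path_between s x v" "path_between t y z" "set s \<inter> set t = {}"
    and T: "T = set s \<union> set t"
    unfolding linked2_def by blast
  let ?p = "map (insert_at i b) p" and ?q = "map (insert_at i b) q"
    and ?s = "map (insert_at i (\<not> b)) s" and ?t = "map (insert_at i (\<not> b)) t"
  have sub: "set p \<subseteq> cube n" "set q \<subseteq> cube n" "set s \<subseteq> cube n" "set t \<subseteq> cube n"
    using assms S T by auto
  have "path_between (?p @ ?s) (insert_at i b u) (insert_at i (\<not> b) v)"
    using path_between_insert_at[OF pq(1) sub(1)] path_between_insert_at[OF st(1) sub(3)]
      subcubes_disjoint[OF sub(1,3)]
    by (intro path_between_append[OF _ _ adj_insert_at_across]) auto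
  moreover have "path_between (?q @ ?t) (insert_at i b w) (insert_at i (\<not> b) z)"
    using path_between_insert_at[OF pq(2) sub(2)] path_between_insert_at[OF st(2) sub(4)]
      subcubes_disjoint[OF sub(2,4)]
    by (intro path_between_append[OF _ _ adj_insert_at_across]) auto
  moreover have "set (?p @ ?s) \<inter> set (?q @ ?t) = {}"
    using insert_at_image_disjoint[OF pq(3) sub(1,2), of i b]
      insert_at_image_disjoint[OF st(3) sub(3,4), of i "\<not> b"]
      subcubes_disjoint[OF sub(1,4), of i b] subcubes_disjoint[OF sub(2,3), of i b]
    by (simp add: Int_Un_distrib Int_Un_distrib2 Int_commute)
  ultimately show ?thesis unfolding linked2_def
    by (intro exI[of _ "?p @ ?s"] exI[of _ "?q @ ?t"]) (auto simp: S T)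
qed

section \<open>Hamiltonian paths\<close>

text \<open>After a cut that separates the ends, the crossing edge may be any whose copy in the half of \<open>u\<close>
  has the parity opposite to \<open>u\<close>: its other copy then has a parity different from that of \<open>v\<close>.\<close>

lemma laceable:
  "1 \<le> n \<Longrightarrow> length u = n \<Longrightarrow> length v = n \<Longrightarrow> even_vertex u \<noteq> even_vertex v \<Longrightarrow>
    linked1 (cube n) u v"
proof (induction n arbitrary: u v rule: nat_induct_at_least)
  case base
  then obtain a c where "u = [a]" "v = [c]" by (auto simp: length_Suc_conv)
  with base have uv: "u = [a]" "v = [\<not> a]" by auto
  have "cube 1 = {[a], [\<not> a]}" by (auto simp: length_Suc_conv)
  then show ?case unfolding linked1_def path_between_def uv
    by (intro exI[of _ "[[a], [\<not> a]]"]) auto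
next
  case (Suc n)
  from Suc.prems have "u \<noteq> v" by auto
  with Suc.prems(1,2) obtain i b u' v' where s: "i \<le> n" "length u' = n" "length v' = n"
    "u = insert_at i b u'" "v = insert_at i (\<not> b) v'"
    by (rule separating_coordinate)
  obtain m where n: "n = Suc m" using Suc.hyps by (cases n) auto
  obtain x where x: "length x = n" "even_vertex x = (\<not> even_vertex u')"
    using exists_vertex_of_parity[of "[]" m] n by auto
  have e: "even_vertex u' \<noteq> even_vertex x" "even_vertex x \<noteq> even_vertex v'"
    using x Suc.prems(3) unfolding s by auto
  have "linked1 (cube n) u' x" "linked1 (cube n) x v'"
    by (rule Suc.IH; fact x s e)+
  then show ?case unfolding s cube_split[OF s(1), of b]
    by (rule linked1_glue[where n = n]) auto
qed

text \<open>The half that contains \<open>r\<close> contains one of the two ends and is covered by induction; the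
  rest of the path is a Hamiltonian path of the other half.\<close>

lemma hyperlaceable:
  "2 \<le> n \<Longrightarrow> length r = n \<Longrightarrow> length u = n \<Longrightarrow> length v = n \<Longrightarrow> u \<noteq> v \<Longrightarrow>
    even_vertex u \<noteq> even_vertex r \<Longrightarrow> even_vertex v \<noteq> even_vertex r \<Longrightarrow>
    linked1 (cube n - {r}) u v"
proof (induction n arbitrary: r u v rule: nat_induct_at_least)
  case base
  obtain a b where r: "r = [a, b]" using base by (auto simp: length_Suc_conv numeral_2_eq_2)
  obtain c d where u: "u = [c, d]" using base by (auto simp: length_Suc_conv numeral_2_eq_2)
  obtain e f where v: "v = [e, f]" using base by (auto simp: length_Suc_conv numeral_2_eq_2)
  have "set [u, [\<not> a, \<not> b], v] = cube 2 - {r}"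
    using base unfolding r u v by (auto simp: length_Suc_conv numeral_2_eq_2)
  moreover have "path_between [u, [\<not> a, \<not> b], v] u v"
    using base unfolding r u v path_between_def by auto
  ultimately show ?case unfolding linked1_def by blast
next
  case (Suc n)
  have main: "linked1 (cube (Suc n) - {r}) u v"
    if r: "length r' = n" "r = insert_at i b r'" and s: "i \<le> n" "length u' = n" "length v' = n"
      "u = insert_at i b u'" "v = insert_at i (\<not> b) v'"
      and e: "even_vertex u \<noteq> even_vertex r" "even_vertex v \<noteq> even_vertex r"
    for r' i b u v u' v'
  proof -
    obtain m where n: "n = Suc m" "1 \<le> m" using Suc.hyps by (cases n) auto
    then have "length [u'] < 2 ^ m" using one_less_power[of "2::nat" m] by simp
    from exists_vertex_of_parity[OF this, of "even_vertex u'"]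
    obtain x where x: "length x = n" "even_vertex x = even_vertex u'" "x \<noteq> u'"
      using n by auto
    have "linked1 (cube n - {r'}) u' x" using x s r e by (intro Suc.IH) auto
    moreover have "linked1 (cube n) x v'" using x s r e Suc.hyps by (intro laceable) auto
    ultimately show ?thesis unfolding s r cube_split_minus[OF s(1) r(1)]
      by (rule linked1_glue[where n = n]) auto
  qed
  from Suc.prems(2-4) obtain i b u' v' where s: "i \<le> n" "length u' = n" "length v' = n"
    "u = insert_at i b u'" "v = insert_at i (\<not> b) v'"
    by (rule separating_coordinate)
  have s': "u = insert_at i (\<not> \<not> b) u'" using s(4) by simp
  show ?case using Suc.prems(1) s(1)
  proof (cases rule: insert_at_cases[where b = b])
    case (1 r')
    show ?thesis by (rule main[OF 1 s Suc.prems(5,6)])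
  next
    case (2 r')
    have "linked1 (cube (Suc n) - {r}) v u"
      by (rule main[OF 2 s(1,3,2,5) s' Suc.prems(6,5)])
    then show ?thesis unfolding linked1_def by (metis path_between_rev set_rev)
  qed
qed

section \<open>Coverings of the cubes of dimension three and four\<close>

lemma adj_Cons:
  "adj (a # u) w \<longleftrightarrow> (\<exists>b v. w = b # v \<and> (if a = b then adj u v else u = v))"
  by (cases w) auto

text \<open>Coordinatewise exclusive or. Translation by \<open>r\<close> is an involutive automorphism of the cube that
  takes \<open>r\<close> to the origin.\<close>

definition translate :: "bool list \<Rightarrow> bool list \<Rightarrow> bool list" where
  "translate = map2 (\<noteq>)"

lemma translate_simps [simp]: "translate [] v = []" "translate (a # u) (b # v) = (a \<noteq> b) # translate u v"
  by (simp_all add: translate_def)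

lemma length_translate [simp]: "length r = length v \<Longrightarrow> length (translate r v) = length v"
  by (simp add: translate_def)

lemma translate_translate [simp]: "length r = length v \<Longrightarrow> translate r (translate r v) = v"
  by (induction r v rule: list_induct2) auto

lemma even_vertex_translate [simp]:
  "length r = length v \<Longrightarrow> even_vertex (translate r v) \<longleftrightarrow> even_vertex r = even_vertex v"
  by (induction r v rule: list_induct2) auto

lemma translate_self [simp]: "translate v v = replicate (length v) False"
  by (induction v) auto

lemma adj_translate: "length r = length u \<Longrightarrow> adj u v \<Longrightarrow> adj (translate r u) (translate r v)"
proof (induction u v arbitrary: r rule: adj.induct)
  case (1 a u b v)
  then obtain c s where "r = c # s" "length s = length u" by (cases r) auto
  then show ?case using 1 by (cases "a = b") auto
qed auto

text \<open>Transpositions of neighbouring coordinates generate all permutations of coordinates.\<close>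

fun swap_at :: "nat \<Rightarrow> bool list \<Rightarrow> bool list" where
  "swap_at 0 (a # b # v) = b # a # v"
| "swap_at (Suc i) (a # v) = a # swap_at i v"
| "swap_at i v = v"

lemma length_swap_at [simp]: "length (swap_at i v) = length v"
  by (induction i v rule: swap_at.induct) auto

lemma swap_at_swap_at [simp]: "swap_at i (swap_at i v) = v"
  by (induction i v rule: swap_at.induct) auto

lemma even_vertex_swap_at [simp]: "even_vertex (swap_at i v) = even_vertex v"
  by (induction i v rule: swap_at.induct) auto

lemma adj_swap_at: "adj u v \<Longrightarrow> adj (swap_at i u) (swap_at i v)"
proof (induction i u arbitrary: v rule: swap_at.induct)
  case (1 a b u)
  then obtain c w where v: "v = c # w" "if a = c then adj (b # u) w else b # u = w"
    by (auto simp only: adj_Cons)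
  then obtain d t where "w = d # t" by (cases w) (auto split: if_splits)
  then show ?case using v by (cases "a = c"; cases "b = d") auto
next
  case (2 i a u)
  then obtain c w where v: "v = c # w" "if a = c then adj u w else u = w"
    by (auto simp only: adj_Cons)
  then show ?case using 2 by (cases "a = c") auto
next
  case ("3_3" a)
  then show ?case by (cases v) (auto split: if_splits)
qed auto

abbreviation swaps :: "nat list \<Rightarrow> bool list \<Rightarrow> bool list" where
  "swaps \<equiv> fold swap_at"

lemma length_swaps [simp]: "length (swaps is v) = length v"
  by (induction "is" arbitrary: v) auto

lemma even_vertex_swaps [simp]: "even_vertex (swaps is v) = even_vertex v"
  by (induction "is" arbitrary: v) auto

lemma swaps_rev [simp]: "swaps (rev is) (swaps is v) = v" "swaps is (swaps (rev is) v) = v"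
  by (induction "is" arbitrary: v) auto

lemma adj_swaps: "adj u v \<Longrightarrow> adj (swaps is u) (swaps is v)"
  by (induction "is" arbitrary: u v) (auto intro: adj_swap_at)

text \<open>Each permutation of four objects is a product of three descending runs, one from each of these
  lists. On shorter lists the transpositions that are out of range act as the identity.\<close>

definition swap_words :: "nat list list" where
  "swap_words = [a @ b @ c. a \<leftarrow> [[], [0]], b \<leftarrow> [[], [1], [1, 0]], c \<leftarrow> [[], [2], [2, 1], [2, 1, 0]]]"

text \<open>The tables list vertices as numbers; the binary digits, least significant first, are the
  coordinates.\<close>

fun bits :: "nat \<Rightarrow> nat \<Rightarrow> bool list" where
  "bits 0 k = []"
| "bits (Suc n) k = odd k # bits n (k div 2)"

definition decode :: "nat \<Rightarrow> (nat list \<times> nat list) list \<Rightarrow> (bool list list \<times> bool list list) list" where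
  "decode n = map (map_prod (map (bits n)) (map (bits n)))"

text \<open>Checkable condition for a table row \<open>(p, q)\<close> to be a covering by two paths after deletion of
  \<open>rs\<close>. Distinctness together with the count \<open>2 ^ n\<close> replaces a comparison of vertex sets.\<close>

definition covers :: "nat \<Rightarrow> bool list list \<Rightarrow> bool list list \<times> bool list list \<Rightarrow> bool" where
  "covers n rs = (\<lambda>(p, q). p \<noteq> [] \<and> q \<noteq> [] \<and> successively adj p \<and> successively adj q \<and>
     list_all (\<lambda>v. length v = n) (rs @ p @ q) \<and> distinct (rs @ p @ q) \<and>
     length (rs @ p @ q) = 2 ^ n)"

lemma linked2_if_covers:
  assumes "covers n rs (p, q)"
  shows "linked2 (cube n - set rs) (hd p) (last p) (hd q) (last q)"
proof -
  have c: "p \<noteq> []" "q \<noteq> []" "successively adj p" "successively adj q"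
    "set (rs @ p @ q) \<subseteq> cube n" "distinct (rs @ p @ q)" "length (rs @ p @ q) = 2 ^ n"
    using assms unfolding covers_def by (auto simp: list_all_iff)
  have "card (set (rs @ p @ q)) = 2 ^ n" using c(6,7) by (metis distinct_card)
  moreover have "finite (cube n)" "card (cube n) = 2 ^ n"
    using finite_lists_length_eq[of "UNIV :: bool set" n]
      card_lists_length_eq[of "UNIV :: bool set" n] by simp_all
  ultimately have "set (rs @ p @ q) = cube n" using c(5) by (intro card_subset_eq) auto
  then have "set p \<union> set q = cube n - set rs" using c(6) by auto
  then show ?thesis unfolding linked2_def path_between_def using c
    by (intro exI[of _ p] exI[of _ q]) auto
qed

definition ends :: "bool list list \<times> bool list list \<Rightarrow> bool list \<times> bool list \<times> bool list \<times> bool list" where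
  "ends = (\<lambda>(p, q). (hd p, last p, hd q, last q))"

lemma linked2_if_ends:
  assumes "list_all (covers n rs) t" "(x, y, u, v) \<in> set (map ends t)"
  shows "linked2 (cube n - set rs) x y u v"
  using assms linked2_if_covers by (fastforce simp: ends_def list_all_iff)

text \<open>The rows were found by a computer search. Their order is that of the enumeration of the ends
  in \<open>table3_ends\<close> and \<open>table4_ends\<close>, so that completeness of a table is one equality of lists. The
  first path starts at the origin in dimension three; in dimension four the origin is the deleted
  vertex.\<close>

definition table3 :: "(nat list \<times> nat list) list" where "table3 = [
   ([0,1], [3,7,5,4,6,2]),
   ([0,1], [3,2,6,7,5,4]),
   ([0,1], [3,2,6,4,5,7]),
   ([0,1], [5,4,6,7,3,2]),
   ([0,1], [5,7,3,2,6,4]),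
   ([0,1], [5,4,6,2,3,7]),
   ([0,1], [6,4,5,7,3,2]),
   ([0,1], [6,2,3,7,5,4]),
   ([0,2,3,1], [6,4,5,7]),
   ([0,2,6,4,5,7], [3,1]),
   ([0,1,5,4,6,7], [3,2]),
   ([0,1,5,7], [3,2,6,4]),
   ([0,4,6,2,3,7], [5,1]),
   ([0,1,3,7], [5,4,6,2]),
   ([0,1,3,2,6,7], [5,4]),
   ([0,2,3,7], [6,4,5,1]),
   ([0,4,5,1,3,7], [6,2]),
   ([0,2,3,1,5,7], [6,4])]"

definition table4 :: "(nat list \<times> nat list) list" where "table4 = [
   ([15,14,12,13,9,8,10,11,3,1], [2,6,7,5,4]),
   ([15,14,12,13,9,8,10,11,3,1], [2,6,4,5,7]),
   ([15,14,12,13,9,11,3,7,6,4,5,1], [2,10,8]),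
   ([15,14,12,13,5,4,6,7,3,1], [2,10,8,9,11]),
   ([15,14,12,8,9,1], [2,10,11,3,7,6,4,5,13]),
   ([15,13,12,8,9,11,3,7,6,4,5,1], [2,10,14]),
   ([15,14,12,13,5,1], [4,6,2,10,8,9,11,3,7]),
   ([15,14,12,13,9,11,3,1], [4,5,7,6,2,10,8]),
   ([15,14,12,13,5,7,3,1], [4,6,2,10,8,9,11]),
   ([15,14,12,8,9,11,10,2,3,1], [4,6,7,5,13]),
   ([15,13,12,8,9,11,10,2,3,1], [4,5,7,6,14]),
   ([15,14,12,13,9,11,3,1], [7,5,4,6,2,10,8]),
   ([15,14,12,13,9,8,10,2,6,4,5,1], [7,3,11]),
   ([15,14,12,8,9,11,10,2,3,1], [7,6,4,5,13]),
   ([15,13,12,8,9,11,10,2,3,1], [7,5,4,6,14]),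
   ([15,14,12,13,9,1], [8,10,2,6,4,5,7,3,11]),
   ([15,14,12,4,5,7,6,2,3,1], [8,10,11,9,13]),
   ([15,13,12,4,5,7,6,2,3,1], [8,9,11,10,14]),
   ([15,14,12,8,9,1], [11,10,2,3,7,6,4,5,13]),
   ([15,13,12,8,9,1], [11,10,2,3,7,5,4,6,14]),
   ([15,11,10,8,9,1], [13,12,4,5,7,3,2,6,14]),
   ([15,14,12,13,9,8,10,11,3,7], [1,5,4,6,2]),
   ([15,14,12,13,9,8,10,11,3,2,6,7], [1,5,4]),
   ([15,14,12,13,9,11,3,7], [1,5,4,6,2,10,8]),
   ([15,14,12,13,9,8,10,2,6,4,5,7], [1,3,11]),
   ([15,14,12,8,10,11,3,2,6,4,5,7], [1,9,13]),
   ([15,13,12,8,9,11,10,2,3,7], [1,5,4,6,14]),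
   ([15,14,12,13,9,8,10,11,3,1,5,7], [2,6,4]),
   ([15,14,12,13,9,11,3,1,5,4,6,7], [2,10,8]),
   ([15,14,12,13,5,4,6,7], [2,3,1,9,8,10,11]),
   ([15,14,12,8,10,11,9,1,3,7], [2,6,4,5,13]),
   ([15,13,12,8,9,11,3,1,5,4,6,7], [2,10,14]),
   ([15,14,12,13,9,11,3,1,5,7], [4,6,2,10,8]),
   ([15,14,12,13,9,8,10,2,6,7], [4,5,1,3,11]),
   ([15,14,12,8,9,1,3,11,10,2,6,7], [4,5,13]),
   ([15,13,12,8,9,11,10,2,3,1,5,7], [4,6,14]),
   ([15,14,12,13,9,1,3,2,6,4,5,7], [8,10,11]),
   ([15,14,12,4,5,1,3,2,6,7], [8,10,11,9,13]),
   ([15,13,12,4,5,7], [8,9,1,3,11,10,2,6,14]),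
   ([15,14,12,8,9,1,3,7], [11,10,2,6,4,5,13]),
   ([15,13,12,8,9,1,3,2,6,4,5,7], [11,10,14]),
   ([15,11,10,8,9,1,3,2,6,7], [13,5,4,12,14]),
   ([3,1], [2,6,7,5,13,15,14,10,11,9,8,12,4]),
   ([3,1], [2,6,4,5,13,12,14,10,8,9,11,15,7]),
   ([3,1], [2,6,7,5,4,12,13,15,14,10,11,9,8]),
   ([3,1], [2,6,7,5,4,12,13,15,14,10,8,9,11]),
   ([3,1], [2,6,7,5,4,12,14,15,11,10,8,9,13]),
   ([3,1], [2,6,7,5,4,12,13,15,11,9,8,10,14]),
   ([3,2,6,14,15,13,12,8,10,11,9,1], [4,5,7]),
   ([3,2,6,7,5,1], [4,12,13,15,14,10,11,9,8]),
   ([3,2,6,7,5,1], [4,12,13,15,14,10,8,9,11]),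
   ([3,2,6,7,5,1], [4,12,14,15,11,10,8,9,13]),
   ([3,2,6,7,5,1], [4,12,13,15,11,9,8,10,14]),
   ([3,2,6,4,5,1], [7,15,14,12,13,9,11,10,8]),
   ([3,2,6,4,5,1], [7,15,14,12,13,9,8,10,11]),
   ([3,2,6,4,5,1], [7,15,14,12,8,10,11,9,13]),
   ([3,2,6,4,5,1], [7,15,13,12,8,9,11,10,14]),
   ([3,2,6,7,5,4,12,13,9,1], [8,10,14,15,11]),
   ([3,2,6,7,15,14,12,4,5,1], [8,10,11,9,13]),
   ([3,2,6,7,5,4,12,13,15,11,9,1], [8,10,14]),
   ([3,2,6,7,5,4,12,14,10,8,9,1], [11,15,13]),
   ([3,2,6,7,15,13,12,4,5,1], [11,9,8,10,14]),
   ([3,2,6,7,5,4,12,8,9,1], [13,15,11,10,14]),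
   ([3,7,6,4], [1,5,13,12,14,15,11,9,8,10,2]),
   ([3,2,6,4], [1,5,13,12,14,10,8,9,11,15,7]),
   ([3,2,6,7,5,4], [1,9,11,10,14,15,13,12,8]),
   ([3,2,6,7,5,4], [1,9,8,10,14,12,13,15,11]),
   ([3,2,6,7,5,4], [1,9,8,10,11,15,14,12,13]),
   ([3,2,6,7,5,4], [1,9,8,10,11,15,13,12,14]),
   ([3,1,5,4], [2,6,14,12,13,9,8,10,11,15,7]),
   ([3,1,5,4], [2,6,7,15,14,12,13,9,11,10,8]),
   ([3,1,5,4], [2,6,7,15,14,12,13,9,8,10,11]),
   ([3,1,5,4], [2,6,7,15,14,12,8,10,11,9,13]),
   ([3,1,5,4], [2,6,7,15,13,12,8,9,11,10,14]),
   ([3,2,6,4], [7,5,1,9,11,10,14,15,13,12,8]),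
   ([3,2,6,4], [7,5,1,9,8,10,14,12,13,15,11]),
   ([3,2,6,4], [7,5,1,9,8,10,11,15,14,12,13]),
   ([3,2,6,4], [7,5,1,9,8,10,11,15,13,12,14]),
   ([3,2,6,7,5,1,9,13,12,4], [8,10,14,15,11]),
   ([3,2,6,7,15,14,12,4], [8,10,11,9,1,5,13]),
   ([3,2,6,7,5,1,9,11,15,13,12,4], [8,10,14]),
   ([3,2,6,7,5,1,9,8,10,14,12,4], [11,15,13]),
   ([3,2,6,7,15,13,12,8,9,1,5,4], [11,10,14]),
   ([3,2,6,7,5,1,9,8,12,4], [13,15,11,10,14]),
   ([3,7], [1,5,4,6,14,15,13,12,8,9,11,10,2]),
   ([3,2,6,7], [1,5,13,15,14,10,11,9,8,12,4]),
   ([3,2,6,7], [1,5,4,12,13,15,14,10,11,9,8]),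
   ([3,2,6,7], [1,5,4,12,13,15,14,10,8,9,11]),
   ([3,2,6,7], [1,5,4,12,14,15,11,10,8,9,13]),
   ([3,2,6,7], [1,5,4,12,13,15,11,9,8,10,14]),
   ([3,1,5,7], [2,6,14,15,13,9,11,10,8,12,4]),
   ([3,1,5,4,6,7], [2,10,11,9,13,15,14,12,8]),
   ([3,1,5,4,6,7], [2,10,8,9,13,12,14,15,11]),
   ([3,1,5,4,6,7], [2,10,11,9,8,12,14,15,13]),
   ([3,1,5,4,6,7], [2,10,11,9,8,12,13,15,14]),
   ([3,2,6,7], [4,5,1,9,11,10,14,15,13,12,8]),
   ([3,2,6,7], [4,5,1,9,8,10,14,12,13,15,11]),
   ([3,2,6,7], [4,5,1,9,8,10,11,15,14,12,13]),
   ([3,2,6,7], [4,5,1,9,8,10,11,15,13,12,14]),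
   ([3,2,6,7], [8,9,1,5,4,12,13,15,14,10,11]),
   ([3,2,6,7], [8,9,1,5,4,12,14,10,11,15,13]),
   ([3,2,6,7], [8,9,1,5,4,12,13,15,11,10,14]),
   ([3,2,6,7], [11,10,8,9,1,5,4,12,14,15,13]),
   ([3,2,6,7], [11,10,8,9,1,5,4,12,13,15,14]),
   ([3,2,6,7], [13,12,4,5,1,9,8,10,11,15,14]),
   ([3,7,6,4,5,13], [1,9,8,12,14,15,11,10,2]),
   ([3,2,6,7,5,13], [1,9,8,10,11,15,14,12,4]),
   ([3,2,6,4,5,13], [1,9,8,12,14,10,11,15,7]),
   ([3,2,6,7,5,4,12,13], [1,9,11,15,14,10,8]),
   ([3,2,6,7,5,4,12,13], [1,9,8,10,14,15,11]),
   ([3,2,6,7,5,4,12,13], [1,9,8,10,11,15,14]),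
   ([3,1,5,7,6,14,15,13], [2,10,11,9,8,12,4]),
   ([3,1,5,4,6,14,12,13], [2,10,8,9,11,15,7]),
   ([3,1,5,4,6,7,15,14,12,13], [2,10,11,9,8]),
   ([3,1,5,4,6,7,15,14,12,13], [2,10,8,9,11]),
   ([3,1,5,4,6,7,15,13], [2,10,11,9,8,12,14]),
   ([3,2,6,14,15,13], [4,12,8,10,11,9,1,5,7]),
   ([3,2,6,7,5,1,9,11,10,14,15,13], [4,12,8]),
   ([3,2,6,7,5,1,9,13], [4,12,8,10,14,15,11]),
   ([3,2,6,7,5,1,9,8,10,11,15,13], [4,12,14]),
   ([3,2,6,4,5,1,9,13], [7,15,11,10,14,12,8]),
   ([3,2,6,4,5,1,9,8,10,14,12,13], [7,15,11]),
   ([3,2,6,4,5,1,9,8,12,13], [7,15,11,10,14]),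
   ([3,2,6,7,15,14,12,4,5,1,9,13], [8,10,11]),
   ([3,2,6,7,15,13], [8,10,11,9,1,5,4,12,14]),
   ([3,2,6,7,15,13], [11,10,8,9,1,5,4,12,14])]"

lemma table3_covers: "list_all (covers 3 []) (decode 3 table3)"
  by code_simp

lemma table4_covers: "list_all (covers 4 [replicate 4 False]) (decode 4 table4)"
  by code_simp

abbreviation all_vertices :: "nat \<Rightarrow> bool list list" where
  "all_vertices n \<equiv> List.n_lists n [False, True]"

lemma set_all_vertices: "set (all_vertices n) = cube n"
  by (auto simp: set_n_lists)

text \<open>Up to permutation of coordinates an odd vertex has one or three entries \<open>True\<close>.\<close>

definition reps3 :: "bool list list" where
  "reps3 = map (bits 3) [1, 7]"

text \<open>Representatives of the positions of \<open>(x, y)\<close> when the origin is deleted: \<open>x\<close> has four or two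
  entries \<open>True\<close>. The odd vertex \<open>y\<close> has one coordinate that differs from the three
  others. If \<open>x\<close> has four entries \<open>True\<close>, then only the value of \<open>y\<close> there matters; if \<open>x\<close> has two,
  then so does the value of \<open>x\<close> there.\<close>

definition reps4 :: "(bool list \<times> bool list) list" where
  "reps4 = map (map_prod (bits 4) (bits 4)) [(15, 1), (15, 7), (3, 1), (3, 4), (3, 7), (3, 13)]"

lemma reps3_complete:
  "list_all (\<lambda>y. \<not> even_vertex y \<longrightarrow> list_ex (\<lambda>is. swaps is y \<in> set reps3) swap_words) (all_vertices 3)"
  unfolding even_vertex_def by code_simp

lemma reps4_complete:
  "list_all (\<lambda>x. even_vertex x \<and> x \<noteq> replicate 4 False \<longrightarrow> list_all (\<lambda>y. \<not> even_vertex y \<longrightarrow>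
     list_ex (\<lambda>is. (swaps is x, swaps is y) \<in> set reps4) swap_words) (all_vertices 4)) (all_vertices 4)"
  unfolding even_vertex_def by code_simp

lemma table3_ends:
  "map ends (decode 3 table3) = [(replicate 3 False, y, u, v). y \<leftarrow> reps3,
     u \<leftarrow> filter (\<lambda>u. even_vertex u \<and> u \<noteq> replicate 3 False) (all_vertices 3),
     v \<leftarrow> filter (\<lambda>v. \<not> even_vertex v \<and> v \<noteq> y) (all_vertices 3)]"
  unfolding even_vertex_def by code_simp

text \<open>One order of each pair is tabulated, as the second path can be reversed.\<close>

fun pairs :: "'a list \<Rightarrow> ('a \<times> 'a) list" where
  "pairs [] = []"
| "pairs (x # xs) = map (Pair x) xs @ pairs xs"

lemma pairs_complete:
  "u \<in> set xs \<Longrightarrow> v \<in> set xs \<Longrightarrow> u \<noteq> v \<Longrightarrow> (u, v) \<in> set (pairs xs) \<or> (v, u) \<in> set (pairs xs)"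
  by (induction xs) auto

lemma table4_ends:
  "map ends (decode 4 table4) = [(x, y, u, v). (x, y) \<leftarrow> reps4,
     (u, v) \<leftarrow> pairs (filter (\<lambda>v. \<not> even_vertex v \<and> v \<noteq> y) (all_vertices 4))]"
  unfolding even_vertex_def by code_simp

text \<open>An automorphism of the cube that takes \<open>r\<close> to the origin.\<close>

definition recoordinate :: "bool list \<Rightarrow> nat list \<Rightarrow> bool list \<Rightarrow> bool list" where
  "recoordinate r is v = swaps is (translate r v)"

lemma length_recoordinate [simp]: "length r = length v \<Longrightarrow> length (recoordinate r is v) = length v"
  by (simp add: recoordinate_def)

lemma even_vertex_recoordinate [simp]:
  "length r = length v \<Longrightarrow> even_vertex (recoordinate r is v) \<longleftrightarrow> even_vertex r = even_vertex v"
  by (simp add: recoordinate_def)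

lemma swap_at_replicate [simp]: "swap_at i (replicate n a) = replicate n a"
proof (induction n arbitrary: i)
  case (Suc n)
  then show ?case by (cases i; cases n) auto
qed (cases i; simp)

lemma swaps_replicate [simp]: "swaps is (replicate n a) = replicate n a"
  by (induction "is") auto

lemma recoordinate_self [simp]: "recoordinate r is r = replicate (length r) False"
  by (simp add: recoordinate_def)

lemma recoordinate_inject [simp]:
  "length u = length r \<Longrightarrow> length v = length r \<Longrightarrow>
    recoordinate r is u = recoordinate r is v \<longleftrightarrow> u = v"
  unfolding recoordinate_def by (metis swaps_rev(1) translate_translate)

text \<open>The inverse automorphism carries a covering found in standard position back.\<close>

lemma linked2_recoordinateD:
  assumes "linked2 (cube n - recoordinate r is ` R)
      (recoordinate r is x) (recoordinate r is y) (recoordinate r is u) (recoordinate r is v)"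
    and len: "length r = n" "length x = n" "length y = n" "length u = n" "length v = n"
      and R: "R \<subseteq> cube n"
  shows "linked2 (cube n - R) x y u v"
proof -
  let ?g = "\<lambda>w. translate r (swaps (rev is) w)"
  have gf: "?g (recoordinate r is w) = w" if "length w = n" for w
    using that len by (simp add: recoordinate_def)
  have fg: "recoordinate r is (?g w) = w" "length (?g w) = n" if "length w = n" for w
    using that len by (simp_all add: recoordinate_def)
  have inj: "inj_on ?g (cube n)"
    by (rule inj_on_inverseI[where g = "recoordinate r is"]) (use fg(1) in simp)
  have "?g ` cube n = cube n"
  proof
    show "cube n \<subseteq> ?g ` cube n"
    proof
      fix w assume "w \<in> cube n"
      then have "length w = n" by simp
      from gf[OF this] show "w \<in> ?g ` cube n"
        by (metis (mono_tags, lifting) \<open>length w = n\<close> image_eqI length_recoordinate len(1) mem_Collect_eq)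
    qed
  qed (use fg(2) in blast)
  moreover have "?g ` recoordinate r is ` R = (\<lambda>w. w) ` R"
    unfolding image_image by (rule image_cong) (use gf R in auto)
  ultimately have img: "?g ` (cube n - recoordinate r is ` R) = cube n - R"
    using R len(1) by (subst inj_on_image_set_diff[OF inj]) auto
  have "linked2 (?g ` (cube n - recoordinate r is ` R)) (?g (recoordinate r is x)) (?g (recoordinate r is y))
    (?g (recoordinate r is u)) (?g (recoordinate r is v))"
    using assms(1)
  proof (rule linked2_map)
    show "inj_on ?g (cube n - recoordinate r is ` R)" using inj by (rule inj_on_subset) auto
    show "adj (?g a) (?g b)" if "a \<in> cube n - recoordinate r is ` R" "adj a b" for a b
      using that len by (intro adj_translate adj_swaps) auto
  qed
  then show ?thesis unfolding img using gf len by simp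
qed

lemma two_neutral_paths_3:
  assumes "length x = 3" "length y = 3" "length u = 3" "length v = 3"
    "x \<noteq> u" "y \<noteq> v" "even_vertex u = even_vertex x"
    "even_vertex y \<noteq> even_vertex x" "even_vertex v \<noteq> even_vertex x"
  shows "linked2 (cube 3) x y u v"
proof -
  have "translate x y \<in> cube 3" "\<not> even_vertex (translate x y)" using assms by auto
  then obtain "is" where i: "recoordinate x is y \<in> set reps3"
    using reps3_complete
    unfolding list_all_iff list_ex_iff set_all_vertices recoordinate_def by blast
  let ?f = "recoordinate x is"
  have "?f u \<noteq> ?f x" "?f v \<noteq> ?f y" using assms by (simp_all del: recoordinate_self)
  then have "(?f x, ?f y, ?f u, ?f v) \<in> set (map ends (decode 3 table3))"
    unfolding table3_ends using assms set_all_vertices[of 3]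
    by simp (intro bexI[OF _ i] exI[of _ "?f u"]; auto)
  from linked2_if_ends[OF table3_covers this]
  have "linked2 (cube 3 - ?f ` {}) (?f x) (?f y) (?f u) (?f v)" by simp
  then have "linked2 (cube 3 - {}) x y u v" by (rule linked2_recoordinateD) (use assms in auto)
  then show ?thesis by simp
qed

lemma one_neutral_one_charged_4:
  assumes "length r = 4" "length x = 4" "length y = 4" "length u = 4" "length v = 4"
    "x \<noteq> r" "even_vertex x = even_vertex r" "distinct [y, u, v]"
    "even_vertex y \<noteq> even_vertex r" "even_vertex u \<noteq> even_vertex r"
    "even_vertex v \<noteq> even_vertex r"
  shows "linked2 (cube 4 - {r}) x y u v"
proof -
  have "translate r x \<noteq> replicate 4 False"
    using assms(1,2,6) translate_translate[of r x] translate_translate[of r r] by (metis translate_self)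
  moreover have "translate r x \<in> cube 4" "even_vertex (translate r x)"
    "translate r y \<in> cube 4" "\<not> even_vertex (translate r y)" using assms by auto
  ultimately obtain "is" where i: "(recoordinate r is x, recoordinate r is y) \<in> set reps4"
    using reps4_complete
    unfolding list_all_iff list_ex_iff set_all_vertices recoordinate_def by blast
  let ?f = "recoordinate r is"
  have ne: "?f y \<noteq> ?f u" "?f y \<noteq> ?f v" "?f v \<noteq> ?f u" using assms by auto
  let ?vs = "filter (\<lambda>v. \<not> even_vertex v \<and> v \<noteq> ?f y) (all_vertices 4)"
  have "?f u \<in> set ?vs" "?f v \<in> set ?vs" using assms ne set_all_vertices[of 4] by auto
  then have "(?f u, ?f v) \<in> set (pairs ?vs) \<or> (?f v, ?f u) \<in> set (pairs ?vs)"
    using ne(3) by (intro pairs_complete) auto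
  then have "(?f x, ?f y, ?f u, ?f v) \<in> set (map ends (decode 4 table4)) \<or>
      (?f x, ?f y, ?f v, ?f u) \<in> set (map ends (decode 4 table4))"
    unfolding table4_ends set_concat set_map by (auto intro!: bexI[OF _ i])
  then have "linked2 (cube 4 - set [replicate 4 False]) (?f x) (?f y) (?f u) (?f v)"
    using linked2_if_ends[OF table4_covers] linked2_rev2 by blast
  then have "linked2 (cube 4 - ?f ` {r}) (?f x) (?f y) (?f u) (?f v)" using assms by simp
  then show ?thesis by (rule linked2_recoordinateD) (use assms in auto)
qed

section \<open>Two neutral paths\<close>

text \<open>The cut separates the starting points \<open>x\<close> and \<open>u\<close>. Where the other ends lie decides whether the
  paths stay in their halves, one of them crosses, or both cross. In the last case the two crossing
  edges must each avoid two vertices of the same parity, which the two-dimensional half of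
  a three-dimensional cube need not permit; therefore the induction starts at three.\<close>

lemma two_neutral_paths:
  "3 \<le> n \<Longrightarrow> length x = n \<Longrightarrow> length y = n \<Longrightarrow> length u = n \<Longrightarrow> length v = n \<Longrightarrow>
    x \<noteq> u \<Longrightarrow> y \<noteq> v \<Longrightarrow> even_vertex u = even_vertex x \<Longrightarrow>
    even_vertex y \<noteq> even_vertex x \<Longrightarrow> even_vertex v \<noteq> even_vertex x \<Longrightarrow>
    linked2 (cube n) x y u v"
proof (induction n arbitrary: x y u v rule: nat_induct_at_least)
  case base
  then show ?case by (intro two_neutral_paths_3) auto
next
  case (Suc n)
  have n: "1 \<le> n" using Suc.hyps by simp
  from Suc.prems(1,3,5) obtain i b x' u' where s: "i \<le> n" "length x' = n" "length u' = n"
    and x: "x = insert_at i b x'" and u: "u = insert_at i (\<not> b) u'"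
    by (rule separating_coordinate)
  have split: "cube (Suc n) = insert_at i (\<not> b) ` cube n \<union> insert_at i b ` cube n"
    using cube_split[OF s(1), of "\<not> b"] by simp
  show ?case using Suc.prems(2,4) s(1)
  proof (cases rule: insert_at_cases2[where b = b])
    case (bn y' v')
    have "linked1 (cube n) x' y'"
      using n s x u bn Suc.prems by (intro laceable) auto
    moreover have "linked1 (cube n) u' v'"
      using n s x u bn Suc.prems by (intro laceable) auto
    ultimately show ?thesis unfolding x u bn cube_split[OF s(1), of b]
      by (rule linked2_side_by_side[where n = n]) auto
  next
    case (bb y' v')
    obtain z where z: "length z = n" "even_vertex z = even_vertex x'" "z \<noteq> x'"
      by (rule exists_vertex_avoiding[OF Suc.hyps])
    have "linked2 (cube n) x' y' z v'"
      using z s x u bb Suc.prems by (intro Suc.IH) auto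
    then have "linked2 (cube n) x' y' v' z" by (rule linked2_rev2)
    moreover have "linked1 (cube n) z u'"
      using n z s x u bb Suc.prems by (intro laceable) auto
    ultimately have "linked2 (cube (Suc n)) x y v u"
      unfolding x u bb cube_split[OF s(1), of b] by (rule linked2_glue1[where n = n]) auto
    then show ?thesis by (rule linked2_rev2)
  next
    case (nn y' v')
    obtain z where z: "length z = n" "even_vertex z = even_vertex u'" "z \<noteq> u'"
      by (rule exists_vertex_avoiding[OF Suc.hyps])
    have "linked2 (cube n) u' v' z y'"
      using z s x u nn Suc.prems by (intro Suc.IH) auto
    then have "linked2 (cube n) u' v' y' z" by (rule linked2_rev2)
    moreover have "linked1 (cube n) z x'"
      using n z s x u nn Suc.prems by (intro laceable) auto
    \<comment> \<open>The halves exchange their roles, hence the double negation.\<close>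
    ultimately have "linked2 (insert_at i (\<not> b) ` cube n \<union> insert_at i (\<not> \<not> b) ` cube n)
        (insert_at i (\<not> b) u') (insert_at i (\<not> b) v') (insert_at i (\<not> b) y') (insert_at i (\<not> \<not> b) x')"
      by (rule linked2_glue1[where n = n]) auto
    then have "linked2 (cube (Suc n)) u v y x" unfolding split x u nn by simp
    then show ?thesis by (rule linked2_swap[OF linked2_rev2])
  next
    case (nb y' v')
    obtain z where z: "length z = n" "even_vertex z \<noteq> even_vertex x'" "z \<noteq> v'" "z \<noteq> u'"
      using exists_vertex_avoiding[OF Suc.hyps, of "\<not> even_vertex x'"] by metis
    obtain t where t: "length t = n" "even_vertex t = even_vertex x'" "t \<noteq> x'" "t \<noteq> y'"
      using exists_vertex_avoiding[OF Suc.hyps, of "even_vertex x'"] by metis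
    have "linked2 (cube n) x' z t v'"
      using z t s x u nb Suc.prems by (intro Suc.IH) auto
    then have "linked2 (cube n) x' z v' t" by (rule linked2_rev2)
    moreover have "linked2 (cube n) z y' u' t"
      using z t s x u nb Suc.prems by (intro Suc.IH) auto
    then have "linked2 (cube n) z y' t u'" by (rule linked2_rev2)
    ultimately have "linked2 (cube (Suc n)) x y v u"
      unfolding x u nb cube_split[OF s(1), of b] by (rule linked2_glue2[where n = n]) auto
    then show ?thesis by (rule linked2_rev2)
  qed
qed

section \<open>One neutral and one charged path\<close>

text \<open>In the local statement \<open>main\<close> the half of \<open>r\<close> is also that of \<open>u\<close>; the charged path crosses to
  \<open>v\<close> exactly once. If \<open>x\<close> and \<open>y\<close> are separated as well, then the neutral path also crosses once,
  at a vertex whose parity makes both of its parts neutral.\<close>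

lemma one_neutral_one_charged:
  "4 \<le> n \<Longrightarrow> length r = n \<Longrightarrow> length x = n \<Longrightarrow> length y = n \<Longrightarrow> length u = n \<Longrightarrow> length v = n \<Longrightarrow>
    x \<noteq> r \<Longrightarrow> even_vertex x = even_vertex r \<Longrightarrow> distinct [y, u, v] \<Longrightarrow>
    even_vertex y \<noteq> even_vertex r \<Longrightarrow> even_vertex u \<noteq> even_vertex r \<Longrightarrow>
    even_vertex v \<noteq> even_vertex r \<Longrightarrow>
    linked2 (cube n - {r}) x y u v"
proof (induction n arbitrary: r x y u v rule: nat_induct_at_least)
  case base
  then show ?case by (intro one_neutral_one_charged_4) auto
next
  case (Suc n)
  have n: "1 \<le> n" "2 \<le> n" "3 \<le> n" using Suc.hyps by simp_all
  have main: "linked2 (cube (Suc n) - {r}) x y u v"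
    if r: "length r' = n" "r = insert_at i b r'" and s: "i \<le> n" "length u' = n" "length v' = n"
      and u: "u = insert_at i b u'" and v: "v = insert_at i (\<not> b) v'"
      and a: "length x = Suc n" "length y = Suc n"
        "x \<noteq> r" "even_vertex x = even_vertex r" "distinct [y, u, v]"
        "even_vertex y \<noteq> even_vertex r" "even_vertex u \<noteq> even_vertex r"
        "even_vertex v \<noteq> even_vertex r"
    for r' i b u v u' v'
  proof -
    have split: "cube (Suc n) - {r} = insert_at i b ` (cube n - {r'}) \<union> insert_at i (\<not> b) ` cube n"
      unfolding r using s(1) r(1) by (rule cube_split_minus)
    show ?thesis using a(1,2) s(1)
    proof (cases rule: insert_at_cases2[where b = b])
      case (bb x' y')
      obtain z where z: "length z = n" "even_vertex z \<noteq> even_vertex r'" "z \<noteq> y'" "z \<noteq> u'"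
        using exists_vertex_avoiding[OF n(3), of "\<not> even_vertex r'"] by metis
      have "linked2 (cube n - {r'}) x' y' u' z"
        using z r s u v bb a by (intro Suc.IH) auto
      moreover have "linked1 (cube n) z v'"
        using n z r s u v bb a by (intro laceable) auto
      ultimately show ?thesis unfolding split bb u v by (rule linked2_glue1[where n = n]) auto
    next
      case (nn x' y')
      obtain z where z: "length z = n" "even_vertex z \<noteq> even_vertex r'" "z \<noteq> x'" "z \<noteq> u'"
        using exists_vertex_avoiding[OF n(3), of "\<not> even_vertex r'"] by metis
      have "linked2 (cube n) x' y' z v'"
        using n z r s u v nn a by (intro two_neutral_paths) auto
      then have "linked2 (cube n) x' y' v' z" by (rule linked2_rev2)
      moreover have "linked1 (cube n - {r'}) z u'"
        using n z r s u v nn a by (intro hyperlaceable) auto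
      ultimately have "linked2 (insert_at i (\<not> b) ` cube n \<union> insert_at i (\<not> \<not> b) ` (cube n - {r'}))
          (insert_at i (\<not> b) x') (insert_at i (\<not> b) y') (insert_at i (\<not> b) v') (insert_at i (\<not> \<not> b) u')"
        by (rule linked2_glue1[where n = n]) auto
      then have "linked2 (cube (Suc n) - {r}) x y v u" unfolding split nn u v by (simp add: Un_commute)
      then show ?thesis by (rule linked2_rev2)
    next
      case (bn x' y')
      obtain z where z: "length z = n" "even_vertex z \<noteq> even_vertex r'" "z \<noteq> u'"
        using exists_vertex_avoiding[OF n(3), of "\<not> even_vertex r'"] by metis
      obtain t where t: "length t = n" "even_vertex t \<noteq> even_vertex r'" "t \<noteq> u'" "t \<noteq> z"
        using exists_vertex_avoiding[OF n(3), of "\<not> even_vertex r'"] by metis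
      have "linked2 (cube n - {r'}) x' z u' t"
        using z t r s u v bn a by (intro Suc.IH) auto
      moreover have "linked2 (cube n) z y' t v'"
        using n z t r s u v bn a by (intro two_neutral_paths) auto
      ultimately show ?thesis unfolding split bn u v by (rule linked2_glue2[where n = n]) auto
    next
      case (nb x' y')
      obtain z where z: "length z = n" "even_vertex z = even_vertex r'" "z \<noteq> r'" "z \<noteq> v'"
        using exists_vertex_avoiding[OF n(3), of "even_vertex r'"] by metis
      obtain t where t: "length t = n" "even_vertex t \<noteq> even_vertex r'" "t \<noteq> y'" "t \<noteq> u'" "t \<noteq> x'"
        using exists_vertex_avoiding[OF n(3), of "\<not> even_vertex r'"] by metis
      have "linked2 (cube n - {r'}) z y' u' t"
        using z t r s u v nb a by (intro Suc.IH) auto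
      then have "linked2 (cube n - {r'}) y' z u' t" by (rule linked2_rev1)
      moreover have "linked2 (cube n) x' z t v'"
        using n z t r s u v nb a by (intro two_neutral_paths) auto
      then have "linked2 (cube n) z x' t v'" by (rule linked2_rev1)
      ultimately have "linked2 (cube (Suc n) - {r}) y x u v"
        unfolding split nb u v by (rule linked2_glue2[where n = n]) auto
      then show ?thesis by (rule linked2_rev1)
    qed
  qed
  have "u \<noteq> v" using Suc.prems(8) by simp
  with Suc.prems(4,5) obtain i b u' v' where s: "i \<le> n" "length u' = n" "length v' = n"
    "u = insert_at i b u'" "v = insert_at i (\<not> b) v'"
    by (rule separating_coordinate)
  have s': "u = insert_at i (\<not> \<not> b) u'" using s(4) by simp
  have d: "distinct [y, v, u]" using Suc.prems(8) by auto
  show ?case using Suc.prems(1) s(1)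
  proof (cases rule: insert_at_cases[where b = b])
    case (1 r')
    show ?thesis by (rule main[OF 1 s Suc.prems(2,3,6-11)])
  next
    case (2 r')
    have "linked2 (cube (Suc n) - {r}) x y v u"
      by (rule main[OF 2 s(1,3,2,5) s' Suc.prems(2,3,6,7) d Suc.prems(9,11,10)])
    then show ?thesis by (rule linked2_rev2)
  qed
qed

section \<open>The hypercube as a graph\<close>

lemma Ex1_nat_split: "(\<exists>!i. P i) \<longleftrightarrow> (if P 0 then \<forall>i. \<not> P (Suc i) else \<exists>!i. P (Suc i))"
proof (cases "P 0")
  case True
  have "\<exists>!i. P i" if none: "\<forall>i. \<not> P (Suc i)"
  proof (rule ex1I)
    show "P 0" by (rule True)
    show "i = 0" if "P i" for i using that none by (cases i) simp_all
  qed
  moreover have "\<not> P (Suc i)" if "\<exists>!i. P i" for i using that True by blast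
  ultimately show ?thesis using True by (simp only: if_True) blast
next
  case False
  have up: "\<exists>!i. P i" if "\<exists>!k. P (Suc k)"
  proof -
    from that obtain k where k: "P (Suc k)" and uniq: "\<And>j. P (Suc j) \<Longrightarrow> j = k" by blast
    show ?thesis
    proof (rule ex1I)
      show "P (Suc k)" by (rule k)
      show "i = Suc k" if "P i" for i using that False uniq by (cases i) simp_all
    qed
  qed
  have down: "\<exists>!k. P (Suc k)" if "\<exists>!i. P i"
  proof -
    from that obtain i where i: "P i" and uniq: "\<And>j. P j \<Longrightarrow> j = i" by blast
    from i False obtain k where k: "i = Suc k" by (cases i) simp_all
    show ?thesis
    proof (rule ex1I)
      show "P (Suc k)" using i k by simp
      show "j = k" if "P (Suc j)" for j using uniq[OF that] k by simp
    qed
  qed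
  show ?thesis unfolding if_not_P[OF False] by (rule iffI[OF down up])
qed

lemma adj_iff_nth:
  "length u = length v \<Longrightarrow> adj u v \<longleftrightarrow> (\<exists>!i. i < length u \<and> u ! i \<noteq> v ! i)"
proof (induction u v rule: list_induct2)
  case (Cons a u b v)
  have "u = v \<longleftrightarrow> (\<forall>i < length u. u ! i = v ! i)"
    using Cons.hyps by (simp add: list_eq_iff_nth_eq)
  then show ?case using Cons.IH by (subst Ex1_nat_split) auto
qed (simp add: Ex1_def)

lemma verts_faulty_cube: "verts (faulty_cube n F) = cube n - F"
  by (simp add: faulty_cube_def hypercube_def)

lemma arcs_ends_faulty_cube:
  "(u, v) \<in> arcs_ends (faulty_cube n F) \<longleftrightarrow> u \<in> cube n - F \<and> v \<in> cube n - F \<and> adj u v"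
  by (auto simp: arcs_ends_conv faulty_cube_def hypercube_def adj_iff_nth)

lemma vpath_faulty_cube:
  "vpath p (faulty_cube n F) \<longleftrightarrow>
    p \<noteq> [] \<and> distinct p \<and> successively adj p \<and> set p \<subseteq> cube n - F"
proof -
  have "set (vwalk_arcs p) \<subseteq> arcs_ends (faulty_cube n F) \<longleftrightarrow> successively adj p"
    if "set p \<subseteq> cube n - F"
    using that by (induction p rule: vwalk_arcs.induct) (auto simp: arcs_ends_faulty_cube)
  then show ?thesis unfolding vpath_def vwalk_def verts_faulty_cube by blast
qed

lemma path_between_ends: "path_between p u v \<Longrightarrow> u \<in> set p \<and> v \<in> set p"
  unfolding path_between_def by auto

lemma path_covering_pair_iff:
  assumes "p \<noteq> q"
  shows "path_covering (faulty_cube n F) {p, q} \<longleftrightarrow>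
    path_between p (hd p) (last p) \<and> path_between q (hd q) (last q) \<and>
    set p \<inter> set q = {} \<and> set p \<union> set q = cube n - F"
  unfolding path_covering_def vpath_faulty_cube verts_faulty_cube disjoint_family_on_def
    path_between_def using assms by auto

lemma has_2_path_covering_iff:
  "has_2_path_covering n r x y u v \<longleftrightarrow> linked2 (cube n - {r}) x y u v"
proof
  assume "has_2_path_covering n r x y u v"
  then obtain p q where pq: "path_covering (faulty_cube n {r}) {p, q}" "card {p, q} = 2"
    "connects p x y" "connects q u v"
    unfolding has_2_path_covering_def k_path_covering_def by blast
  then have "p \<noteq> q" by auto
  then show "linked2 (cube n - {r}) x y u v"
    using pq path_covering_pair_iff[of p q n "{r}"] unfolding linked2_def connects_def by blast
next
  assume "linked2 (cube n - {r}) x y u v"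
  then obtain p q where pq: "path_between p x y" "path_between q u v"
    "set p \<inter> set q = {}" "set p \<union> set q = cube n - {r}" unfolding linked2_def by blast
  have "p \<noteq> q" using path_between_ends[OF pq(1)] pq(3) by blast
  then show "has_2_path_covering n r x y u v"
    unfolding has_2_path_covering_def k_path_covering_def connects_def
    using pq \<open>p \<noteq> q\<close> path_covering_pair_iff[OF \<open>p \<noteq> q\<close>, of n "{r}"]
    by (intro exI[of _ p] exI[of _ q]) (simp add: path_between_def)
qed

text \<open>A covering with the given end pairs has exactly two paths: any path of it has an end in
  common with one of two chosen paths, and distinct paths are disjoint.\<close>

lemma covering_with_end_pairs_iff:
  assumes "distinct [x, y, u, v]"
  shows "(\<exists>P. path_covering (faulty_cube n F) P \<and> end_pairs P = {{x, y}, {u, v}}) \<longleftrightarrow>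
    linked2 (cube n - F) x y u v"
proof
  assume "\<exists>P. path_covering (faulty_cube n F) P \<and> end_pairs P = {{x, y}, {u, v}}"
  then obtain P where P: "path_covering (faulty_cube n F) P" "end_pairs P = {{x, y}, {u, v}}"
    by blast
  then have vp: "\<And>p. p \<in> P \<Longrightarrow> path_between p (hd p) (last p)"
    and disj: "\<And>p q. p \<in> P \<Longrightarrow> q \<in> P \<Longrightarrow> p \<noteq> q \<Longrightarrow> set p \<inter> set q = {}"
    and un: "(\<Union>p\<in>P. set p) = cube n - F"
    unfolding path_covering_def vpath_faulty_cube verts_faulty_cube disjoint_family_on_def
      path_between_def by auto
  have xy: "{x, y} \<in> end_pairs P" and uv: "{u, v} \<in> end_pairs P" unfolding P(2) by simp_all
  from xy obtain p where p: "{x, y} = {hd p, last p}" "p \<in> P"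
    unfolding end_pairs_def by (rule imageE)
  from uv obtain q where q: "{u, v} = {hd q, last q}" "q \<in> P"
    unfolding end_pairs_def by (rule imageE)
  have sub: "{x, y} \<subseteq> set p" "{u, v} \<subseteq> set q"
    unfolding p(1) q(1) using path_between_ends[OF vp[OF p(2)]] path_between_ends[OF vp[OF q(2)]]
    by simp_all
  have PQ: "P = {p, q}"
  proof
    show "P \<subseteq> {p, q}"
    proof
      fix s assume s: "s \<in> P"
      then have "{hd s, last s} \<in> {{x, y}, {u, v}}" unfolding P(2)[symmetric] end_pairs_def by (rule imageI)
      then have "{hd s, last s} = {x, y} \<or> {hd s, last s} = {u, v}" by simp
      then have "hd s \<in> {x, y} \<union> {u, v}"
        by (metis Un_iff insertI1)
      then have "hd s \<in> set p \<union> set q" using sub by (meson Un_mono subsetD)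
      moreover have "hd s \<in> set s" using path_between_ends[OF vp[OF s]] by simp
      ultimately show "s \<in> {p, q}" using disj[OF s p(2)] disj[OF s q(2)] by blast
    qed
  qed (use p(2) q(2) in simp)
  have "{x, y} \<noteq> {u, v}" using assms by (auto simp: doubleton_eq_iff)
  then have "p \<noteq> q" using p(1) q(1) by metis
  moreover have "set p \<union> set q = cube n - F" using un unfolding PQ by simp
  ultimately have l: "linked2 (cube n - F) (hd p) (last p) (hd q) (last q)"
    unfolding linked2_def using vp[OF p(2)] vp[OF q(2)] disj[OF p(2) q(2)]
    by (intro exI[of _ p] exI[of _ q]) simp
  have "(x = hd p \<and> y = last p) \<or> (x = last p \<and> y = hd p)"
    "(u = hd q \<and> v = last q) \<or> (u = last q \<and> v = hd q)"
    using p(1) q(1) by (simp_all add: doubleton_eq_iff)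
  then show "linked2 (cube n - F) x y u v"
    using l linked2_rev1[OF l] linked2_rev2[OF l] linked2_rev2[OF linked2_rev1[OF l]] by auto
next
  assume "linked2 (cube n - F) x y u v"
  then obtain p q where pq: "path_between p x y" "path_between q u v"
    "set p \<inter> set q = {}" "set p \<union> set q = cube n - F" unfolding linked2_def by blast
  have "p \<noteq> q" using path_between_ends[OF pq(1)] pq(3) by blast
  then show "\<exists>P. path_covering (faulty_cube n F) P \<and> end_pairs P = {{x, y}, {u, v}}"
    using pq path_covering_pair_iff[OF \<open>p \<noteq> q\<close>, of n F]
    by (intro exI[of _ "{p, q}"]) (simp add: path_between_def end_pairs_def)
qed

section \<open>Prescribable ends and the bracket\<close>

lemma neutral_pair_iff: "neutral {u, v} \<longleftrightarrow> even_vertex u \<noteq> even_vertex v"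
  unfolding neutral_def by (auto simp: doubleton_eq_iff)

lemma charged_pair_iff: "charged {u, v} \<longleftrightarrow> u \<noteq> v \<and> even_vertex u = even_vertex v"
  unfolding charged_def by (auto simp: doubleton_eq_iff)

lemma red_excess_singleton: "red_excess c {r} = (if red c r then 1 else - 1)"
proof -
  have "{v \<in> {r}. red c v} = (if red c r then {r} else {})"
    "{v \<in> {r}. green c v} = (if red c r then {} else {r})" by auto
  then show ?thesis unfolding red_excess_def by simp
qed

text \<open>Balance is what forces the charged pair to have the colour opposite to that of \<open>r\<close>.\<close>

lemma prescribable_ends_one_one_iff:
  "prescribable_ends c n {r} 1 1 E \<longleftrightarrow> (\<exists>x y u v. E = {{x, y}, {u, v}} \<and>
     distinct [x, y, u, v] \<and> {x, y, u, v} \<subseteq> cube n - {r} \<and>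
     even_vertex x = even_vertex r \<and> even_vertex y \<noteq> even_vertex r \<and>
     even_vertex u \<noteq> even_vertex r \<and> even_vertex v \<noteq> even_vertex r)"
    (is "?L \<longleftrightarrow> ?R")
proof -
  have counts: "card {e \<in> {{x, y}, {u, v}}. neutral e} = 1" "card {e \<in> {{x, y}, {u, v}}. charged e} = 1"
    "int (card {e \<in> {{x, y}, {u, v}}. green_pair c e}) - int (card {e \<in> {{x, y}, {u, v}}. red_pair c e}) =
      (if red c u then - 1 else 1)"
    if "even_vertex x \<noteq> even_vertex y" "u \<noteq> v" "even_vertex u = even_vertex v" for x y u v
  proof -
    have "{e \<in> {{x, y}, {u, v}}. neutral e} = {{x, y}}" "{e \<in> {{x, y}, {u, v}}. charged e} = {{u, v}}"
      using that neutral_pair_iff charged_pair_iff by blast+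
    then show "card {e \<in> {{x, y}, {u, v}}. neutral e} = 1" "card {e \<in> {{x, y}, {u, v}}. charged e} = 1"
      by simp_all
    have "red c u = red c v" using that unfolding red_def by simp
    then have "{e \<in> {{x, y}, {u, v}}. green_pair c e} = (if red c u then {} else {{u, v}})"
      "{e \<in> {{x, y}, {u, v}}. red_pair c e} = (if red c u then {{u, v}} else {})"
      using that unfolding green_pair_def red_pair_def by (auto simp: charged_pair_iff)
    then show "int (card {e \<in> {{x, y}, {u, v}}. green_pair c e}) - int (card {e \<in> {{x, y}, {u, v}}. red_pair c e}) =
      (if red c u then - 1 else 1)" by simp
  qed
  show ?thesis
  proof
    assume ?L
    then have two: "\<And>e. e \<in> E \<Longrightarrow> card e = 2" and disj: "disjoint E"
      and vs: "\<Union> E \<subseteq> cube n - {r}"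
      and bal: "red_excess c {r} = int (card {e \<in> E. green_pair c e}) - int (card {e \<in> E. red_pair c e})"
      and N: "card {e \<in> E. neutral e} = 1" and K: "card {e \<in> E. charged e} = 1"
      unfolding prescribable_ends_def disjoint_pairs_def in_balance_def verts_faulty_cube by auto
    obtain e where e: "{e \<in> E. neutral e} = {e}" using N by (rule card_1_singletonE)
    obtain f where f: "{e \<in> E. charged e} = {f}" using K by (rule card_1_singletonE)
    have "e \<in> E" "neutral e" "f \<in> E" "charged f" using e f by blast+
    have "neutral d \<or> charged d" if d: "d \<in> E" for d
    proof -
      obtain a b where "d = {a, b}" "a \<noteq> b" using two[OF d] by (meson card_2_iff)
      then show ?thesis by (cases "even_vertex a = even_vertex b") (simp_all add: neutral_pair_iff charged_pair_iff)
    qed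
    then have E: "E = {e, f}" using e f by blast
    obtain x0 y0 where e0: "e = {x0, y0}" "even_vertex x0 \<noteq> even_vertex y0"
      using \<open>neutral e\<close> unfolding neutral_def by blast
    obtain x y where xy: "e = {x, y}" "even_vertex x = even_vertex r" "even_vertex y \<noteq> even_vertex r"
    proof (cases "even_vertex x0 = even_vertex r")
      case True
      then show ?thesis using that[of x0 y0] e0 by simp
    next
      case False
      then show ?thesis using that[of y0 x0] e0 by (auto simp: insert_commute)
    qed
    obtain u v where uv: "f = {u, v}" "u \<noteq> v" "even_vertex u = even_vertex v"
      using \<open>charged f\<close> unfolding charged_def by blast
    have "e \<noteq> f" using xy uv by (auto simp: doubleton_eq_iff)
    then have "e \<inter> f = {}" using disj \<open>e \<in> E\<close> \<open>f \<in> E\<close> by (auto dest: disjointD)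
    then have d: "distinct [x, y, u, v]" using xy uv by auto
    have "red_excess c {r} = (if red c u then - 1 else 1)"
      using bal counts(3)[of x y u v] xy uv unfolding E by simp
    then have "red c u \<noteq> red c r" unfolding red_excess_singleton by (auto split: if_splits)
    then have u: "even_vertex u \<noteq> even_vertex r" unfolding red_def by auto
    then have v: "even_vertex v \<noteq> even_vertex r" using uv(3) by simp
    have Exy: "E = {{x, y}, {u, v}}" using E xy(1) uv(1) by simp
    have "{x, y, u, v} \<subseteq> cube n - {r}" using vs unfolding Exy by simp
    then show ?R using Exy d xy(2,3) u v by metis
  next
    assume ?R
    then obtain x y u v where E: "E = {{x, y}, {u, v}}" and d: "distinct [x, y, u, v]"
      and vs: "{x, y, u, v} \<subseteq> cube n - {r}" and par: "even_vertex x = even_vertex r"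
        "even_vertex y \<noteq> even_vertex r" "even_vertex u \<noteq> even_vertex r" "even_vertex v \<noteq> even_vertex r"
      by blast
    have "disjoint_pairs E" using d unfolding disjoint_pairs_def E disjoint_def by auto
    moreover have "red c u \<noteq> red c r" using par unfolding red_def by auto
    then have "in_balance c n {r} E"
      using vs d par counts(3)[of x y u v]
      unfolding in_balance_def verts_faulty_cube E red_excess_singleton by auto
    ultimately show ?L unfolding prescribable_ends_def
      using counts(1,2)[of x y u v] d par unfolding E by simp
  qed
qed

lemma path_between_inner_vertex:
  assumes "path_between p u v" "w \<in> set p" "w \<noteq> u" "w \<noteq> v"
  obtains xs s t ys where "p = xs @ s # w # t # ys" "adj s w" "adj w t"
proof -
  obtain as bs where p: "p = as @ w # bs" using assms(2) by (meson split_list)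
  obtain xs s where "as = xs @ [s]" using assms p by (cases as rule: rev_cases) (auto simp: path_between_def)
  moreover obtain t ys where "bs = t # ys" using assms p by (cases bs) (auto simp: path_between_def)
  ultimately have p: "p = xs @ s # w # t # ys" using p by simp
  moreover have "adj s w" "adj w t"
    using assms(1) unfolding p path_between_def by (auto simp: successively_append_iff)
  ultimately show ?thesis by (rule that)
qed

text \<open>The vertex \<open>w\<close> below has the neighbours \<open>r\<close>, \<open>x\<close> and \<open>s\<close>, and \<open>s\<close> has the neighbours \<open>w\<close>,
  \<open>u\<close> and \<open>v\<close>. Neither \<open>w\<close> nor \<open>s\<close> is an end, so \<open>x\<close>, \<open>w\<close>, \<open>s\<close> would have to be consecutive
  on the path of \<open>x\<close>, which could then go on only to an end of the other path. The
  first coordinate \<open>d\<close> selects the parity of the deleted vertex.\<close>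

lemma no_two_paths_3:
  "\<not> linked2 (cube 3 - {[d, False, False]})
     [\<not> d, True, False] [d, True, False] [d, False, True] [\<not> d, True, True]"
proof
  let ?r = "[d, False, False]" and ?x = "[\<not> d, True, False]" and ?y = "[d, True, False]"
    and ?u = "[d, False, True]" and ?v = "[\<not> d, True, True]"
  let ?w = "[\<not> d, False, False]" and ?s = "[\<not> d, False, True]"
  assume "linked2 (cube 3 - {?r}) ?x ?y ?u ?v"
  then obtain p q where p: "path_between p ?x ?y" and q: "path_between q ?u ?v"
    and disj: "set p \<inter> set q = {}" and un: "set p \<union> set q = cube 3 - {?r}"
    unfolding linked2_def by blast
  have nw: "t = ?x \<or> t = ?s" if "adj ?w t \<or> adj t ?w" "t \<in> set p \<union> set q" for t
    using that(1) that(2)[unfolded un] adj_sym[of t ?w] by (auto simp: adj_Cons split: if_splits)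
  have ns: "t = ?w \<or> t = ?u \<or> t = ?v" if "adj ?s t" for t
    using that by (auto simp: adj_Cons split: if_splits)
  note ends = path_between_ends[OF p] path_between_ends[OF q]
  have "?w \<in> set p \<union> set q" unfolding un by simp
  then show False
  proof
    assume "?w \<in> set q"
    then obtain xs s t ys where "q = xs @ s # ?w # t # ys" "adj s ?w" "adj ?w t"
      by (rule path_between_inner_vertex[OF q]) auto
    moreover from this have "s \<noteq> t" using q by (auto simp: path_between_def)
    ultimately have "?x \<in> set q" using nw[of s] nw[of t] by auto
    then show False using ends disj by blast
  next
    assume "?w \<in> set p"
    then obtain xs s t ys where 1: "p = xs @ s # ?w # t # ys" "adj s ?w" "adj ?w t"
      by (rule path_between_inner_vertex[OF p]) auto
    then have "s \<noteq> t" "t \<noteq> hd p" using p by (cases xs; auto simp: path_between_def)+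
    then have t: "t = ?s" using nw[of t] 1 p by (auto simp: path_between_def)
    then have "?s \<in> set p" using 1 by simp
    then obtain xs' s' t' ys' where 2: "p = xs' @ s' # ?s # t' # ys'" "adj ?s t'"
      by (rule path_between_inner_vertex[OF p]) auto
    have "distinct p" using p by (simp add: path_between_def)
    \<comment> \<open>A vertex occurs only once on \<open>p\<close>, so both decompositions split it at the same place.\<close>
    then have "xs @ [s, ?w] = xs' @ [s']"
      using 1(1)[unfolded t] 2(1) by (auto simp: append_eq_append_conv2 append_eq_Cons_conv Cons_eq_append_conv)
    then have "s' = ?w" by simp
    then have "t' \<noteq> ?w" using \<open>distinct p\<close> 2(1) by auto
    then have "t' \<in> set q" using ns[OF 2(2)] ends by blast
    then show False using 2(1) disj by auto
  qed
qed

lemma freely_prescribable_one_one: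
  assumes "4 \<le> n" "r \<in> cube n"
  shows "freely_prescribe_ends c n {r} 1 1"
  unfolding freely_prescribe_ends_def
proof (intro conjI allI impI)
  have n: "3 \<le> n" using assms by simp
  obtain x where x: "length x = n" "even_vertex x = even_vertex r" "x \<noteq> r"
    by (rule exists_vertex_avoiding[OF n])
  obtain y where y: "length y = n" "even_vertex y = (\<not> even_vertex r)"
    by (rule exists_vertex_avoiding[OF n])
  obtain u where u: "length u = n" "even_vertex u = (\<not> even_vertex r)" "u \<noteq> y"
    by (rule exists_vertex_avoiding[OF n])
  obtain v where v: "length v = n" "even_vertex v = (\<not> even_vertex r)" "v \<noteq> y" "v \<noteq> u"
    by (rule exists_vertex_avoiding[OF n])
  have "distinct [x, y, u, v]" "{x, y, u, v} \<subseteq> cube n - {r}"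
    using x y u v by auto
  then show "\<exists>E. prescribable_ends c n {r} 1 1 E"
    unfolding prescribable_ends_one_one_iff using x y u v by blast
next
  fix E assume "prescribable_ends c n {r} 1 1 E"
  then obtain x y u v where E: "E = {{x, y}, {u, v}}" and d: "distinct [x, y, u, v]"
    and vs: "{x, y, u, v} \<subseteq> cube n - {r}" and par: "even_vertex x = even_vertex r"
      "even_vertex y \<noteq> even_vertex r" "even_vertex u \<noteq> even_vertex r" "even_vertex v \<noteq> even_vertex r"
    unfolding prescribable_ends_one_one_iff by blast
  have "linked2 (cube n - {r}) x y u v"
    using assms d vs par by (intro one_neutral_one_charged) simp_all
  then show "\<exists>P. path_covering (faulty_cube n {r}) P \<and> end_pairs P = E"
    unfolding E covering_with_end_pairs_iff[OF d] .
qed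

lemma not_freely_prescribable_3: "\<not> freely_prescribe_ends c 3 {[d, False, False]} 1 1"
proof
  let ?r = "[d, False, False]" and ?x = "[\<not> d, True, False]" and ?y = "[d, True, False]"
    and ?u = "[d, False, True]" and ?v = "[\<not> d, True, True]"
  have d: "distinct [?x, ?y, ?u, ?v]" by auto
  have "{?x, ?y, ?u, ?v} \<subseteq> cube 3 - {?r}" by auto
  moreover have "even_vertex ?x = even_vertex ?r" "even_vertex ?y \<noteq> even_vertex ?r"
    "even_vertex ?u \<noteq> even_vertex ?r" "even_vertex ?v \<noteq> even_vertex ?r" by auto
  ultimately have "prescribable_ends c 3 {?r} 1 1 {{?x, ?y}, {?u, ?v}}"
    unfolding prescribable_ends_one_one_iff using d by blast
  moreover assume "freely_prescribe_ends c 3 {?r} 1 1"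
  ultimately have "linked2 (cube 3 - {?r}) ?x ?y ?u ?v"
    unfolding freely_prescribe_ends_def using covering_with_end_pairs_iff[OF d] by metis
  then show False using no_two_paths_3 by blast
qed

text \<open>Membership of \<open>m\<close> is a condition on all dimensions from \<open>m\<close> on, so the counterexample in
  dimension three excludes every \<open>m \<le> 3\<close>.\<close>

lemma mem_A_set_iff: "m \<in> A_set c 1 1 1 1 \<longleftrightarrow> 4 \<le> m"
proof
  assume "m \<in> A_set c 1 1 1 1"
  then have free: "freely_prescribe_ends c 3 F 1 1"
    if "m \<le> 3" "fault 3 F" "mass F = 1" "charge c F = 1" for F
    using that unfolding A_set_def by blast
  have "fault 3 {[False, False, False]}" "mass {[False, False, False]} = 1"
    "charge c {[False, False, False]} = 1"
    by (simp_all add: fault_def hypercube_def mass_def charge_def red_excess_singleton)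
  then have "\<not> m \<le> 3" using free not_freely_prescribable_3 by blast
  then show "4 \<le> m" by simp
next
  assume m: "4 \<le> m"
  have "log 2 6 \<le> log 2 (2 ^ 4)" by (subst log_le_cancel_iff) auto
  also have "\<dots> = 4" by (subst log_pow_cancel) auto
  finally have "log 2 6 \<le> (4::real)" .
  then have "log 2 (real (1 + 1 + 2 * 1 + 2 * 1)) \<le> real m" using m by simp
  moreover have "freely_prescribe_ends c n F 1 1" if "m \<le> n" "fault n F" "mass F = 1" for n F
  proof -
    obtain r where "F = {r}" using \<open>mass F = 1\<close> unfolding mass_def by (rule card_1_singletonE)
    then show ?thesis using that m
      using freely_prescribable_one_one[of n r c] by (simp add: fault_def hypercube_def)
  qed
  ultimately show "m \<in> A_set c 1 1 1 1" unfolding A_set_def by simp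
qed

lemma admissible_vertices_iff:
  "admissible_vertices c n r x y u v \<longleftrightarrow> even_vertex r = c \<and> r \<in> cube n \<and> x \<noteq> r \<and>
     {x, y, u, v} \<subseteq> cube n \<and> even_vertex x = even_vertex r \<and> distinct [y, u, v] \<and>
     even_vertex y \<noteq> even_vertex r \<and> even_vertex u \<noteq> even_vertex r \<and> even_vertex v \<noteq> even_vertex r"
  unfolding admissible_vertices_def verts_faulty_cube red_def by (auto simp: hypercube_def)

theorem lemma3p11:
  fixes c :: bool
  shows "bracket c 1 1 1 1 = Some 4 \<and>
    (\<forall>n\<ge>4. \<forall>r r1 g g1 g2. admissible_vertices c n r r1 g g1 g2 \<longrightarrow>
        has_2_path_covering n r r1 g g1 g2) \<and>
    (\<exists>r r1 g g1 g2. admissible_vertices c 3 r r1 g g1 g2 \<and>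
        \<not> has_2_path_covering 3 r r1 g g1 g2)"
proof (intro conjI allI impI)
  have "A_set c 1 1 1 1 = {4..}" by (rule set_eqI) (simp only: mem_A_set_iff atLeast_iff)
  moreover have "(LEAST m. m \<in> {4::nat..}) = 4" by (rule Least_equality) auto
  ultimately show "bracket c 1 1 1 1 = Some 4" unfolding bracket_def by simp
next
  fix n r r1 g g1 g2
  assume "4 \<le> n" "admissible_vertices c n r r1 g g1 g2"
  then show "has_2_path_covering n r r1 g g1 g2"
    unfolding has_2_path_covering_iff admissible_vertices_iff
    by (intro one_neutral_one_charged) simp_all
next
  have "admissible_vertices c 3 [\<not> c, False, False]
      [\<not> \<not> c, True, False] [\<not> c, True, False] [\<not> c, False, True] [\<not> \<not> c, True, True]"
    unfolding admissible_vertices_iff by auto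
  then show "\<exists>r r1 g g1 g2. admissible_vertices c 3 r r1 g g1 g2 \<and>
      \<not> has_2_path_covering 3 r r1 g g1 g2"
    unfolding has_2_path_covering_iff using no_two_paths_3[of "\<not> c"] by blast
qed

end
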